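(* Let $\{\mathcal{A}_n\mid n\ge 0\}$ be a multiplicity-free family of algebras over a field $\Bbbk$ and let $(J_n\mid n\in\mathbb{N})$ be a separating sequence. Then for any $n\ge1$ and any $\mathsf T=(\lambda_0\to\lambda_1\to\cdots\to\lambda_n)\in\operatorname{Tab}(n)$, $$\varepsilon_{\mathsf T}=\varepsilon_{\overline{\mathsf T}}\,P_{\mathsf T}(J_n).$$ Hence $$\varepsilon_{\mathsf T}=\prod_{k=1}^{n}P_{\mathsf T[k]}(J_k),$$ where $\mathsf T[k]=(\lambda_0\to\cdots\to\lambda_k)\in\operatorname{Tab}(k)$ is the subpath of $\mathsf T$ up to the vertex $\lambda_k$.
   Context: All algebras are finite-dimensional, associative and unital. A finite-dimensional algebra over $\Bbbk$ is split semisimple if it is isomorphic to a direct sum of matrix algebras over $\Bbbk$. A multiplicity-free family of algebras over $\Bbbk$ is a family $\{\mathcal{A}_n\mid n\ge 0\}$ of finite-dimensional split semisimple $\Bbbk$-algebras such that: (a) $\mathcal{A}_0\cong\Bbbk$; (b) for each $n$ there is a unity-preserving algebra embedding $\mathcal{A}_n\hookrightarrow\mathcal{A}_{n+1}$ (by which $\mathcal{A}_n$ is regarded as a subalgebra of $\mathcal{A}_{n+1}$); (c) the restriction to $\mathcal{A}_{n-1}$ of any irreducible $\mathcal{A}_n$-module is isomorphic to a direct sum of pairwise non-isomorphic irreducible $\mathcal{A}_{n-1}$-modules. $\operatorname{Irr}(n)$ is the set of isomorphism classes of irreducible left $\mathcal{A}_n$-modules, and $V^\lambda$ is a representative of $\lambda\in\operatorname{Irr}(n)$.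 For $\lambda\in\operatorname{Irr}(n)$, $\varepsilon(\lambda)\in Z(\mathcal{A}_n)$ is the primitive central idempotent of $\mathcal{A}_n$ acting as the identity on $V^\lambda$ and as zero on $V^{\lambda'}$ for $\lambda\ne\lambda'\in\operatorname{Irr}(n)$. The branching graph has vertex set $\bigsqcup_{n\ge0}\operatorname{Irr}(n)$, with an edge $\mu\to\lambda$ ($\mu\in\operatorname{Irr}(n-1)$, $\lambda\in\operatorname{Irr}(n)$) if and only if $V^\mu$ is isomorphic to a direct summand of the restriction of $V^\lambda$ to $\mathcal{A}_{n-1}$. $\operatorname{Tab}(n)$ is the set of paths $\mathsf T=(\lambda_0\to\lambda_1\to\cdots\to\lambda_n)$ in the branching graph starting at the unique element $\lambda_0=\varnothing$ of $\operatorname{Irr}(0)$, with $\lambda_k\in\operatorname{Irr}(k)$; $\overline{\mathsf T}\in\operatorname{Tab}(n-1)$ is obtained from $\mathsf T$ by deleting its last edge. Set $\varepsilon_{\mathsf T}=\varepsilon(\lambda_1)\cdots\varepsilon(\lambda_n)\in\mathcal{A}_n$ (equal to $1$ if $n=0$). For $n\ge1$, $\mathcal{X}_n$ is the (commutative) subalgebra of $\mathcal{A}_n$ generated by $Z(\mathcal{A}_1),\dots,Z(\mathcal{A}_n)$; $\{\varepsilon_{\mathsf T}\mid\mathsf T\in\operatorname{Tab}(n)\}$ is a $\Bbbk$-basis of $\mathcal{X}_n$, and $\mathcal{X}_1\subset\mathcal{X}_2\subset\cdots$. A sequence $(J_n\mid n\in\mathbb{N})$, $\mathbb{N}=\{1,2,\dots\}$,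 with $J_n\in\mathcal{X}_n$ for all $n$, is separating if $\mathcal{X}_n=\langle J_1,\dots,J_n\rangle$ (the subalgebra generated by $J_1,\dots,J_n$) for all $n\in\mathbb{N}$. For $\mathsf T\in\operatorname{Tab}(n)$ and $1\le k\le n$ the scalars $c_{\mathsf T}(k)\in\Bbbk$ are defined by $J_k=\sum_{\mathsf T\in\operatorname{Tab}(n)}c_{\mathsf T}(k)\,\varepsilon_{\mathsf T}$. For $\mathsf T\in\operatorname{Tab}(n)$, $$P_{\mathsf T}(J_n)=\prod_{\substack{\mathsf S\in\operatorname{Tab}(n)\\ \mathsf S\ne\mathsf T,\ \overline{\mathsf S}=\overline{\mathsf T}}}\frac{J_n-c_{\mathsf S}(n)}{c_{\mathsf T}(n)-c_{\mathsf S}(n)},$$ which is well defined because the denominators are nonzero for a separating sequence. *)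

theory Defs
  imports "Jordan_Normal_Form.VS_Connect" "HOL-Algebra.Subrings"
begin

section \<open>Finite-dimensional algebras over a field\<close>

text \<open>The ground field is a type \<open>'k\<close> of class \<^class>\<open>field\<close>, seen as the HOL-Algebra ring
  \<open>class_ring\<close>.  An algebra is carried by the HOL-Algebra record \<^typ>\<open>('k, 'a) module\<close>, which
  holds both the ring operations and the scalar multiplication.  (The library locale
  \<^locale>\<open>algebra\<close> is restricted to commutative algebras.)\<close>

definition fd_algebra :: "('k::field, 'a) module \<Rightarrow> bool" where
  "fd_algebra A \<longleftrightarrow>
     ring A \<and> vectorspace class_ring A \<and> vectorspace.fin_dim class_ring A \<and>
     (\<forall>c. \<forall>x\<in>carrier A. \<forall>y\<in>carrier A.
        (c \<odot>\<^bsub>A\<^esub> x) \<otimes>\<^bsub>A\<^esub> y = c \<odot>\<^bsub>A\<^esub> (x \<otimes>\<^bsub>A\<^esub> y) \<and>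
        x \<otimes>\<^bsub>A\<^esub> (c \<odot>\<^bsub>A\<^esub> y) = c \<odot>\<^bsub>A\<^esub> (x \<otimes>\<^bsub>A\<^esub> y))"

text \<open>Unity is preserved, since \<^const>\<open>Ring.ring_hom\<close> demands it.\<close>

definition algebra_hom :: "('k::field, 'a) module \<Rightarrow> ('k, 'b) module \<Rightarrow> ('a \<Rightarrow> 'b) set" where
  "algebra_hom A B = Ring.ring_hom A B \<inter> LinearCombinations.module_hom class_ring A B"

definition algebra_isomorphic :: "('k::field, 'a) module \<Rightarrow> ('k, 'b) module \<Rightarrow> bool" where
  "algebra_isomorphic A B \<longleftrightarrow> (\<exists>f \<in> algebra_hom A B. bij_betw f (carrier A) (carrier B))"

definition ground_algebra :: "('k::field, 'k) module" where
  "ground_algebra =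
     \<lparr>carrier = UNIV, mult = (*), one = 1, zero = 0, add = (+), smult = (*)\<rparr>"

text \<open>Componentwise operations on the product of a family; for a finite index set this is the
  direct sum, both of algebras and of modules.\<close>

definition family_sum :: "'i set \<Rightarrow> ('i \<Rightarrow> ('s, 'b) module) \<Rightarrow> ('s, 'i \<Rightarrow> 'b) module" where
  "family_sum I M =
     \<lparr>carrier = (\<Pi>\<^sub>E i\<in>I. carrier (M i)),
      mult = (\<lambda>f g. \<lambda>i\<in>I. f i \<otimes>\<^bsub>M i\<^esub> g i),
      one = (\<lambda>i\<in>I. \<one>\<^bsub>M i\<^esub>),
      zero = (\<lambda>i\<in>I. \<zero>\<^bsub>M i\<^esub>),
      add = (\<lambda>f g. \<lambda>i\<in>I. f i \<oplus>\<^bsub>M i\<^esub> g i),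
      smult = (\<lambda>c f. \<lambda>i\<in>I. c \<odot>\<^bsub>M i\<^esub> f i)\<rparr>"

definition split_semisimple :: "('k::field, 'a) module \<Rightarrow> bool" where
  "split_semisimple A \<longleftrightarrow>
     fd_algebra A \<and>
     (\<exists>(r::nat) (d::nat \<Rightarrow> nat).
        (\<forall>i<r. d i \<ge> 1) \<and>
        algebra_isomorphic A (family_sum {..<r} (\<lambda>i. module_mat TYPE('k) (d i) (d i))))"

definition centre :: "('k, 'a) module \<Rightarrow> 'a set" where
  "centre A = {z \<in> carrier A. \<forall>x\<in>carrier A. z \<otimes>\<^bsub>A\<^esub> x = x \<otimes>\<^bsub>A\<^esub> z}"

definition unital_subalgebra :: "'a set \<Rightarrow> ('k, 'a) module \<Rightarrow> bool" where
  "unital_subalgebra B A \<longleftrightarrow> subring B A \<and> (\<forall>c. \<forall>b\<in>B. c \<odot>\<^bsub>A\<^esub> b \<in> B)"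

definition generated_subalgebra :: "('k, 'a) module \<Rightarrow> 'a set \<Rightarrow> 'a set" where
  "generated_subalgebra A S = \<Inter>{B. unital_subalgebra B A \<and> S \<subseteq> B}"

definition primitive_central_idempotent :: "('k, 'a) module \<Rightarrow> 'a \<Rightarrow> bool" where
  "primitive_central_idempotent A e \<longleftrightarrow>
     e \<in> centre A \<and> e \<otimes>\<^bsub>A\<^esub> e = e \<and> e \<noteq> \<zero>\<^bsub>A\<^esub> \<and>
     (\<forall>f\<in>centre A. \<forall>g\<in>centre A.
        f \<otimes>\<^bsub>A\<^esub> f = f \<and> g \<otimes>\<^bsub>A\<^esub> g = g \<and> f \<otimes>\<^bsub>A\<^esub> g = \<zero>\<^bsub>A\<^esub> \<and> e = f \<oplus>\<^bsub>A\<^esub> g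
        \<longrightarrow> f = \<zero>\<^bsub>A\<^esub> \<or> g = \<zero>\<^bsub>A\<^esub>)"


section \<open>Left modules\<close>

text \<open>As the library locale \<^locale>\<open>module\<close>, but over a ring that need not be commutative.  For
  modules over a \<open>'k\<close>-algebra the \<open>'k\<close>-structure is the induced one, through the scalar multiples
  of the unity.\<close>

locale left_module = R?: ring R + M?: abelian_group M
  for R :: "('a, 'm) ring_scheme" (structure) and M :: "('a, 'v) module" (structure) +
  assumes smult_closed:
      "\<lbrakk>a \<in> carrier R; x \<in> carrier M\<rbrakk> \<Longrightarrow> a \<odot>\<^bsub>M\<^esub> x \<in> carrier M"
    and smult_l_distr:
      "\<lbrakk>a \<in> carrier R; b \<in> carrier R; x \<in> carrier M\<rbrakk> \<Longrightarrow>
       (a \<oplus> b) \<odot>\<^bsub>M\<^esub> x = a \<odot>\<^bsub>M\<^esub> x \<oplus>\<^bsub>M\<^esub> b \<odot>\<^bsub>M\<^esub> x"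
    and smult_r_distr:
      "\<lbrakk>a \<in> carrier R; x \<in> carrier M; y \<in> carrier M\<rbrakk> \<Longrightarrow>
       a \<odot>\<^bsub>M\<^esub> (x \<oplus>\<^bsub>M\<^esub> y) = a \<odot>\<^bsub>M\<^esub> x \<oplus>\<^bsub>M\<^esub> a \<odot>\<^bsub>M\<^esub> y"
    and smult_assoc1:
      "\<lbrakk>a \<in> carrier R; b \<in> carrier R; x \<in> carrier M\<rbrakk> \<Longrightarrow>
       (a \<otimes> b) \<odot>\<^bsub>M\<^esub> x = a \<odot>\<^bsub>M\<^esub> (b \<odot>\<^bsub>M\<^esub> x)"
    and smult_one:
      "x \<in> carrier M \<Longrightarrow> \<one> \<odot>\<^bsub>M\<^esub> x = x"

definition left_submodule :: "('k, 'a) module \<Rightarrow> 'v set \<Rightarrow> ('a, 'v) module \<Rightarrow> bool" where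
  "left_submodule A W M \<longleftrightarrow>
     subgroup W (add_monoid M) \<and> (\<forall>a\<in>carrier A. \<forall>w\<in>W. a \<odot>\<^bsub>M\<^esub> w \<in> W)"

definition irreducible_module :: "('k, 'a) module \<Rightarrow> ('a, 'v) module \<Rightarrow> bool" where
  "irreducible_module A M \<longleftrightarrow>
     left_module A M \<and> carrier M \<noteq> {\<zero>\<^bsub>M\<^esub>} \<and>
     (\<forall>W. left_submodule A W M \<longrightarrow> W = {\<zero>\<^bsub>M\<^esub>} \<or> W = carrier M)"

definition module_isomorphic ::
    "('k, 'a) module \<Rightarrow> ('a, 'v) module \<Rightarrow> ('a, 'w) module \<Rightarrow> bool" where
  "module_isomorphic A M N \<longleftrightarrow> (\<exists>f \<in> LinearCombinations.module_hom A M N. bij_betw f (carrier M) (carrier N))"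

definition isomorphic_to_summand ::
    "('k, 'a) module \<Rightarrow> ('a, 'v) module \<Rightarrow> ('a, 'w) module \<Rightarrow> bool" where
  "isomorphic_to_summand A N M \<longleftrightarrow>
     (\<exists>U U'. left_submodule A U M \<and> left_submodule A U' M \<and>
        U \<inter> U' = {\<zero>\<^bsub>M\<^esub>} \<and> U <+>\<^bsub>M\<^esub> U' = carrier M \<and>
        module_isomorphic A N (M\<lparr>carrier := U\<rparr>))"

definition restrict_scalars :: "('a \<Rightarrow> 'b) \<Rightarrow> ('b, 'v) module \<Rightarrow> ('a, 'v) module" where
  "restrict_scalars \<phi> M =
     \<lparr>carrier = carrier M, mult = mult M, one = one M, zero = zero M, add = add M,
      smult = (\<lambda>a v. \<phi> a \<odot>\<^bsub>M\<^esub> v)\<rparr>"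

text \<open>Isomorphism classes of irreducible left modules.  The modules range over those whose carrier
  lies in the type \<open>'a\<close> of the algebra: a simple module over \<open>A\<close> is isomorphic to a minimal left
  ideal when \<open>A\<close> is semisimple, so every isomorphism class is represented there.\<close>

definition Irr :: "('k, 'a) module \<Rightarrow> ('a, 'a) module set set" where
  "Irr A = {M. irreducible_module A M} //
     {(M, N). irreducible_module A M \<and> irreducible_module A N \<and> module_isomorphic A M N}"

definition irr_rep :: "('a, 'a) module set \<Rightarrow> ('a, 'a) module" where
  "irr_rep \<nu> = (SOME M. M \<in> \<nu>)"

definition eps :: "('k, 'a) module \<Rightarrow> ('a, 'a) module set \<Rightarrow> 'a" where
  "eps A \<nu> = (THE e. primitive_central_idempotent A e \<and>
     (\<forall>v\<in>carrier (irr_rep \<nu>). e \<odot>\<^bsub>irr_rep \<nu>\<^esub> v = v) \<and>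
     (\<forall>\<nu>'\<in>Irr A. \<nu>' \<noteq> \<nu> \<longrightarrow>
        (\<forall>v\<in>carrier (irr_rep \<nu>'). e \<odot>\<^bsub>irr_rep \<nu>'\<^esub> v = \<zero>\<^bsub>irr_rep \<nu>'\<^esub>)))"


section \<open>Multiplicity-free families\<close>

text \<open>\<open>\<iota> n\<close> is the embedding of \<open>A n\<close> into \<open>A (Suc n)\<close>.\<close>

definition multiplicity_free_family ::
    "(nat \<Rightarrow> ('k::field, 'a) module) \<Rightarrow> (nat \<Rightarrow> 'a \<Rightarrow> 'a) \<Rightarrow> bool" where
  "multiplicity_free_family A \<iota> \<longleftrightarrow>
     (\<forall>n. split_semisimple (A n)) \<and>
     algebra_isomorphic (A 0) (ground_algebra :: ('k, 'k) module) \<and>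
     (\<forall>n. \<iota> n \<in> algebra_hom (A n) (A (Suc n)) \<and> inj_on (\<iota> n) (carrier (A n))) \<and>
     (\<forall>n. \<forall>V :: ('a, 'a) module. irreducible_module (A (Suc n)) V \<longrightarrow>
        (\<exists>(r::nat) (W :: nat \<Rightarrow> ('a, 'a) module).
           (\<forall>i<r. irreducible_module (A n) (W i)) \<and>
           (\<forall>i<r. \<forall>j<r. i \<noteq> j \<longrightarrow> \<not> module_isomorphic (A n) (W i) (W j)) \<and>
           module_isomorphic (A n) (restrict_scalars (\<iota> n) V) (family_sum {..<r} W)))"

text \<open>The embedding of \<open>A m\<close> into \<open>A n\<close> for \<open>m \<le> n\<close>, that is \<open>\<iota> (n - 1) \<circ> \<dots> \<circ> \<iota> m\<close>, by which
  elements of \<open>A m\<close> are regarded as elements of \<open>A n\<close>.\<close>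

definition incl :: "(nat \<Rightarrow> 'a \<Rightarrow> 'a) \<Rightarrow> nat \<Rightarrow> nat \<Rightarrow> 'a \<Rightarrow> 'a" where
  "incl \<iota> m n = fold \<iota> [m..<n]"

text \<open>The edge relation from \<open>Irr (A n)\<close> to \<open>Irr (A (Suc n))\<close>.\<close>

definition branching_edge ::
    "(nat \<Rightarrow> ('k, 'a) module) \<Rightarrow> (nat \<Rightarrow> 'a \<Rightarrow> 'a) \<Rightarrow> nat \<Rightarrow>
     ('a, 'a) module set \<Rightarrow> ('a, 'a) module set \<Rightarrow> bool" where
  "branching_edge A \<iota> n \<mu> \<nu> \<longleftrightarrow>
     isomorphic_to_summand (A n) (irr_rep \<mu>) (restrict_scalars (\<iota> n) (irr_rep \<nu>))"

text \<open>A path is the list \<open>[\<lambda>\<^sub>0, \<dots>, \<lambda>\<^sub>n]\<close> of its vertices, so \<open>butlast\<close> deletes the last edge and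
  \<open>take (Suc k)\<close> is the subpath up to \<open>\<lambda>\<^sub>k\<close>.\<close>

definition Tab ::
    "(nat \<Rightarrow> ('k, 'a) module) \<Rightarrow> (nat \<Rightarrow> 'a \<Rightarrow> 'a) \<Rightarrow> nat \<Rightarrow> ('a, 'a) module set list set" where
  "Tab A \<iota> n = {T. length T = Suc n \<and> (\<forall>k\<le>n. T ! k \<in> Irr (A k)) \<and>
     (\<forall>k<n. branching_edge A \<iota> k (T ! k) (T ! Suc k))}"

text \<open>The ordered product of \<open>eps (A k) \<lambda>\<^sub>k\<close> for \<open>k = 1, \<dots>, n\<close>, in \<open>A n\<close>.\<close>

definition eps_path ::
    "(nat \<Rightarrow> ('k, 'a) module) \<Rightarrow> (nat \<Rightarrow> 'a \<Rightarrow> 'a) \<Rightarrow> ('a, 'a) module set list \<Rightarrow> 'a" where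
  "eps_path A \<iota> T = (let n = length T - 1 in
     foldr (mult (A n)) (map (\<lambda>k. incl \<iota> k n (eps (A k) (T ! k))) [1..<Suc n]) \<one>\<^bsub>A n\<^esub>)"

definition GZ :: "(nat \<Rightarrow> ('k, 'a) module) \<Rightarrow> (nat \<Rightarrow> 'a \<Rightarrow> 'a) \<Rightarrow> nat \<Rightarrow> 'a set" where
  "GZ A \<iota> n = generated_subalgebra (A n) (\<Union>k\<in>{1..n}. incl \<iota> k n ` centre (A k))"

text \<open>\<open>GZ A \<iota> n\<close> as a commutative algebra in its own right.  Products indexed by sets are taken in
  it, because \<^const>\<open>finprod\<close> is meant for commutative monoids only.\<close>

definition GZ_algebra ::
    "(nat \<Rightarrow> ('k, 'a) module) \<Rightarrow> (nat \<Rightarrow> 'a \<Rightarrow> 'a) \<Rightarrow> nat \<Rightarrow> ('k, 'a) module" where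
  "GZ_algebra A \<iota> n = (A n)\<lparr>carrier := GZ A \<iota> n\<rparr>"

definition separating ::
    "(nat \<Rightarrow> ('k, 'a) module) \<Rightarrow> (nat \<Rightarrow> 'a \<Rightarrow> 'a) \<Rightarrow> (nat \<Rightarrow> 'a) \<Rightarrow> bool" where
  "separating A \<iota> J \<longleftrightarrow>
     (\<forall>n\<ge>1. J n \<in> GZ A \<iota> n) \<and>
     (\<forall>n\<ge>1. GZ A \<iota> n = generated_subalgebra (A n) ((\<lambda>k. incl \<iota> k n (J k)) ` {1..n}))"

text \<open>The coordinates of \<open>J k\<close>, regarded as an element of \<open>A n\<close>, in the basis given by the
  elements \<open>eps_path A \<iota> T\<close> for \<open>T \<in> Tab A \<iota> n\<close>.\<close>

definition path_coords ::
    "(nat \<Rightarrow> ('k, 'a) module) \<Rightarrow> (nat \<Rightarrow> 'a \<Rightarrow> 'a) \<Rightarrow> (nat \<Rightarrow> 'a) \<Rightarrow> nat \<Rightarrow> nat \<Rightarrow>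
     ('a, 'a) module set list \<Rightarrow> 'k" where
  "path_coords A \<iota> J n k = (THE c. c \<in> extensional (Tab A \<iota> n) \<and>
     incl \<iota> k n (J k) = (\<Oplus>\<^bsub>A n\<^esub>T\<in>Tab A \<iota> n. c T \<odot>\<^bsub>A n\<^esub> eps_path A \<iota> T))"

definition content ::
    "(nat \<Rightarrow> ('k, 'a) module) \<Rightarrow> (nat \<Rightarrow> 'a \<Rightarrow> 'a) \<Rightarrow> (nat \<Rightarrow> 'a) \<Rightarrow>
     ('a, 'a) module set list \<Rightarrow> nat \<Rightarrow> 'k" where
  "content A \<iota> J T k = path_coords A \<iota> J (length T - 1) k T"

text \<open>The element \<open>P\<^sub>T(J\<^sub>n)\<close> for \<open>T \<in> Tab A \<iota> n\<close>.\<close>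

definition interpolant ::
    "(nat \<Rightarrow> ('k::field, 'a) module) \<Rightarrow> (nat \<Rightarrow> 'a \<Rightarrow> 'a) \<Rightarrow> (nat \<Rightarrow> 'a) \<Rightarrow>
     ('a, 'a) module set list \<Rightarrow> 'a" where
  "interpolant A \<iota> J T = (let n = length T - 1 in
     (\<Otimes>\<^bsub>GZ_algebra A \<iota> n\<^esub>S\<in>{S \<in> Tab A \<iota> n. S \<noteq> T \<and> butlast S = butlast T}.
        (1 / (content A \<iota> J T n - content A \<iota> J S n)) \<odot>\<^bsub>A n\<^esub>
        (J n \<ominus>\<^bsub>A n\<^esub> content A \<iota> J S n \<odot>\<^bsub>A n\<^esub> \<one>\<^bsub>A n\<^esub>)))"

end

theory Submission
  imports Defs
begin

text \<open>Write \<open>E\<^sub>T\<close> for the path idempotent of \<open>T\<close>.  The idea is that the elements \<open>E\<^sub>T\<close>, for the paths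
  \<open>T\<close> of length \<open>n\<close>, are nonzero orthogonal idempotents with sum \<open>1\<close>, and that multiplication by an
  element of the Gelfand-Zetlin algebra acts on each of them as a scalar.  An identity between
  elements of \<open>A\<^sub>n\<close> can therefore be checked after multiplication by each \<open>E\<^sub>S\<close> (\<open>path_ext\<close>), and this
  turns the theorem into Lagrange interpolation: \<open>P\<^sub>T(J\<^sub>n)\<close> acts on \<open>E\<^sub>S\<close> by the scalar
  \<open>\<Prod>\<^sub>R (c\<^sub>S(n) - c\<^sub>R(n)) / (c\<^sub>T(n) - c\<^sub>R(n))\<close>, which is \<open>1\<close> for \<open>S = T\<close> and \<open>0\<close> for every other \<open>S\<close> that
  extends the same path of length \<open>n - 1\<close>; the idempotent of that shorter path kills all remaining
  \<open>E\<^sub>S\<close> and fixes \<open>E\<^sub>T\<close>.  The denominators are nonzero (\<open>content_separates\<close>) because two paths which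
  agree except in the last vertex, and which also had the same content there, would give the same
  scalars for \<open>J\<^sub>1, \<dots>, J\<^sub>n\<close>, hence for everything these generate, hence for \<open>E\<^sub>S\<close> itself.  The product
  formula follows by induction on \<open>n\<close>.

  Two bodies of facts carry this.  The first is the representation theory of one split semisimple
  algebra.  All that is taken from the matrix algebras is recorded in the locale \<open>block_algebra\<close>:
  the identities \<open>e i\<close> of the blocks, and in each block an idempotent \<open>p i\<close> of rank one.  Every
  irreducible module is then isomorphic to exactly one of the left ideals \<open>A p i\<close>, so that
  irreducible modules and blocks correspond, \<^const>\<open>eps\<close> takes the values \<open>e i\<close>, and the centre acts
  by scalars on each \<open>e i\<close>.

  The second is the passage from \<open>A\<^sub>n\<close> to \<open>A\<^sub>n\<^sub>+\<^sub>1\<close>, by the recursion \<open>E\<^sub>T = \<iota>(E\<^sub>S) \<epsilon>(\<nu>)\<close> for the path \<open>T\<close>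
  obtained from \<open>S\<close> by the edge to \<open>\<nu>\<close>.  Orthogonality follows from it because \<open>\<epsilon>(\<nu>)\<close> is central.  That
  the sum is \<open>1\<close> requires \<open>\<iota>(\<epsilon>(\<mu>)) \<epsilon>(\<nu>) = 0\<close> whenever there is no edge from \<open>\<mu>\<close> to \<open>\<nu>\<close>
  (\<open>non_edge_zero\<close>); that \<open>E\<^sub>T \<noteq> 0\<close> is seen on a vector of the irreducible module at the end of the
  path, transported along the edges (\<open>eps_path_acts_nonzero\<close>).\<close>

section \<open>Algebras over a field\<close>

lemma (in abelian_group) add_idem_zero: "x \<in> carrier G \<Longrightarrow> x \<oplus> x = x \<Longrightarrow> x = \<zero>"
  using add.l_cancel_one[of x x] by simp

locale algebra_over = ring A for A :: "('k::field, 'a) module" (structure) +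
  assumes fd: "fd_algebra A"
begin

lemma module_class_ring: "Module.module class_ring A"
  using fd by (simp add: fd_algebra_def vectorspace_def)

lemma scale_closed [simp, intro]: "x \<in> carrier A \<Longrightarrow> c \<odot> x \<in> carrier A"
  using module.smult_closed[OF module_class_ring] by simp

lemma add_scale: "x \<in> carrier A \<Longrightarrow> (c + d) \<odot> x = c \<odot> x \<oplus> d \<odot> x"
  using module.smult_l_distr[OF module_class_ring, of c d] by simp

lemma scale_scale [simp]: "x \<in> carrier A \<Longrightarrow> c \<odot> (d \<odot> x) = (c * d) \<odot> x"
  using module.smult_assoc1[OF module_class_ring, of c d] by simp

lemma one_scale [simp]: "x \<in> carrier A \<Longrightarrow> 1 \<odot> x = x"
  using module.smult_one[OF module_class_ring] by simp

lemma scale_mult_left [simp]: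
  "x \<in> carrier A \<Longrightarrow> y \<in> carrier A \<Longrightarrow> (c \<odot> x) \<otimes> y = c \<odot> (x \<otimes> y)"
  and scale_mult_right [simp]:
  "x \<in> carrier A \<Longrightarrow> y \<in> carrier A \<Longrightarrow> x \<otimes> (c \<odot> y) = c \<odot> (x \<otimes> y)"
  using fd by (auto simp: fd_algebra_def)

lemma zero_scale [simp]: "x \<in> carrier A \<Longrightarrow> 0 \<odot> x = \<zero>"
  by (intro add_idem_zero) (auto simp flip: add_scale)

lemma scale_zero [simp]: "c \<odot> \<zero> = \<zero>"
  using zero_scale[of \<zero>] scale_scale[of \<zero> c 0] by simp

lemma minus_scale: "x \<in> carrier A \<Longrightarrow> (- c) \<odot> x = \<ominus> (c \<odot> x)"
  using add_scale[of x "- c" c] by (simp add: minus_equality)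

lemma scale_eq_zero: "x \<in> carrier A \<Longrightarrow> c \<odot> x = \<zero> \<Longrightarrow> x \<noteq> \<zero> \<Longrightarrow> c = 0"
  using scale_scale[of x "inverse c" c] by (cases "c = 0") auto

lemma scale_inject:
  assumes "x \<in> carrier A" "x \<noteq> \<zero>" "c \<odot> x = d \<odot> x" shows "c = d"
proof -
  have "(c - d) \<odot> x = c \<odot> x \<oplus> (- d) \<odot> x" using add_scale[of x c "- d"] assms by simp
  also have "\<dots> = \<zero>" using assms minus_scale[of x d] by (simp add: r_neg)
  finally show ?thesis using scale_eq_zero[of x "c - d"] assms by simp
qed

lemma centre_closed [simp]: "z \<in> centre A \<Longrightarrow> z \<in> carrier A"
  by (simp add: centre_def)

lemma centre_commutes: "z \<in> centre A \<Longrightarrow> x \<in> carrier A \<Longrightarrow> z \<otimes> x = x \<otimes> z"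
  unfolding centre_def by blast

lemma unital_subalgebraI:
  assumes "H \<subseteq> carrier A" "\<one> \<in> H"
    and "\<And>x y. x \<in> H \<Longrightarrow> y \<in> H \<Longrightarrow> x \<oplus> y \<in> H"
    and "\<And>x y. x \<in> H \<Longrightarrow> y \<in> H \<Longrightarrow> x \<otimes> y \<in> H"
    and sc: "\<And>c x. x \<in> H \<Longrightarrow> c \<odot> x \<in> H"
  shows "unital_subalgebra H A"
proof -
  have "\<ominus> h \<in> H" if "h \<in> H" for h
    using minus_scale[of h 1] sc[OF that, of "- 1"] that assms(1) by auto
  then show ?thesis using assms by (auto simp: unital_subalgebra_def intro!: subringI)
qed

lemma unital_subalgebraD:
  assumes "unital_subalgebra H A"
  shows "H \<subseteq> carrier A" "\<one> \<in> H" "\<zero> \<in> H"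
    and "x \<in> H \<Longrightarrow> y \<in> H \<Longrightarrow> x \<oplus> y \<in> H"
    and "x \<in> H \<Longrightarrow> y \<in> H \<Longrightarrow> x \<otimes> y \<in> H"
    and "x \<in> H \<Longrightarrow> c \<odot> x \<in> H"
    and "x \<in> H \<Longrightarrow> \<ominus> x \<in> H"
  using subringE[of H A] assms by (auto simp: unital_subalgebra_def)

lemma unital_subalgebra_generated:
  assumes "S \<subseteq> carrier A" shows "unital_subalgebra (generated_subalgebra A S) A"
proof -
  let ?F = "{B. unital_subalgebra B A \<and> S \<subseteq> B}"
  have "unital_subalgebra (carrier A) A" by (rule unital_subalgebraI) auto
  then have "?F \<noteq> {}" using assms by blast
  then have "subring (\<Inter>?F) A"
    by (rule subring_Inter[rotated]) (simp add: unital_subalgebra_def)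
  moreover have "c \<odot> b \<in> \<Inter>?F" if "b \<in> \<Inter>?F" for c b
    using that by (simp add: unital_subalgebra_def)
  ultimately show ?thesis unfolding generated_subalgebra_def unital_subalgebra_def[of "\<Inter>_"] by blast
qed

lemma generated_subalgebra_least:
  "unital_subalgebra B A \<Longrightarrow> S \<subseteq> B \<Longrightarrow> generated_subalgebra A S \<subseteq> B"
  by (auto simp: generated_subalgebra_def)

lemma generated_subalgebra_incl: "S \<subseteq> generated_subalgebra A S"
  by (auto simp: generated_subalgebra_def)

end

lemma algebra_overI: "fd_algebra A \<Longrightarrow> algebra_over A"
  by (simp add: algebra_over_def algebra_over_axioms_def fd_algebra_def)

lemma algebra_homD:
  assumes "f \<in> algebra_hom A B"
  shows "x \<in> carrier A \<Longrightarrow> f x \<in> carrier B"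
    and "x \<in> carrier A \<Longrightarrow> y \<in> carrier A \<Longrightarrow> f (x \<otimes>\<^bsub>A\<^esub> y) = f x \<otimes>\<^bsub>B\<^esub> f y"
    and "x \<in> carrier A \<Longrightarrow> y \<in> carrier A \<Longrightarrow> f (x \<oplus>\<^bsub>A\<^esub> y) = f x \<oplus>\<^bsub>B\<^esub> f y"
    and "f \<one>\<^bsub>A\<^esub> = \<one>\<^bsub>B\<^esub>"
    and "x \<in> carrier A \<Longrightarrow> f (c \<odot>\<^bsub>A\<^esub> x) = c \<odot>\<^bsub>B\<^esub> f x"
  using assms by (auto simp: algebra_hom_def Ring.ring_hom_def LinearCombinations.module_hom_def)

lemma algebra_hom_zero:
  assumes "algebra_over A" "algebra_over B" "f \<in> algebra_hom A B"
  shows "f \<zero>\<^bsub>A\<^esub> = \<zero>\<^bsub>B\<^esub>"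
  using assms ring_hom_zero[of f A B] by (auto simp: algebra_over_def algebra_hom_def)

section \<open>Left modules\<close>

lemma left_moduleD:
  assumes "left_module A M"
  shows "ring A" "abelian_group M"
    and "a \<in> carrier A \<Longrightarrow> x \<in> carrier M \<Longrightarrow> a \<odot>\<^bsub>M\<^esub> x \<in> carrier M"
    and "a \<in> carrier A \<Longrightarrow> b \<in> carrier A \<Longrightarrow> x \<in> carrier M \<Longrightarrow>
       (a \<oplus>\<^bsub>A\<^esub> b) \<odot>\<^bsub>M\<^esub> x = a \<odot>\<^bsub>M\<^esub> x \<oplus>\<^bsub>M\<^esub> b \<odot>\<^bsub>M\<^esub> x"
    and "a \<in> carrier A \<Longrightarrow> x \<in> carrier M \<Longrightarrow> y \<in> carrier M \<Longrightarrow>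
       a \<odot>\<^bsub>M\<^esub> (x \<oplus>\<^bsub>M\<^esub> y) = a \<odot>\<^bsub>M\<^esub> x \<oplus>\<^bsub>M\<^esub> a \<odot>\<^bsub>M\<^esub> y"
    and "a \<in> carrier A \<Longrightarrow> b \<in> carrier A \<Longrightarrow> x \<in> carrier M \<Longrightarrow>
       (a \<otimes>\<^bsub>A\<^esub> b) \<odot>\<^bsub>M\<^esub> x = a \<odot>\<^bsub>M\<^esub> (b \<odot>\<^bsub>M\<^esub> x)"
    and "x \<in> carrier M \<Longrightarrow> \<one>\<^bsub>A\<^esub> \<odot>\<^bsub>M\<^esub> x = x"
  using assms left_module.axioms(1,2)[OF assms] left_module.smult_closed[OF assms]
    left_module.smult_l_distr[OF assms] left_module.smult_r_distr[OF assms]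
    left_module.smult_assoc1[OF assms] left_module.smult_one[OF assms]
  by auto

lemma left_module_smult_zero:
  assumes "left_module A M" "a \<in> carrier A"
  shows "a \<odot>\<^bsub>M\<^esub> \<zero>\<^bsub>M\<^esub> = \<zero>\<^bsub>M\<^esub>"
proof -
  interpret M: abelian_group M using left_moduleD(2)[OF assms(1)] .
  show ?thesis
    using left_moduleD(3)[OF assms(1)] assms(2)
    by (intro M.add_idem_zero) (auto simp flip: left_moduleD(5)[OF assms(1)])
qed

lemma left_module_zero_smult:
  assumes "left_module A M" "x \<in> carrier M"
  shows "\<zero>\<^bsub>A\<^esub> \<odot>\<^bsub>M\<^esub> x = \<zero>\<^bsub>M\<^esub>"
proof -
  interpret A: ring A using left_moduleD(1)[OF assms(1)] .
  interpret M: abelian_group M using left_moduleD(2)[OF assms(1)] .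
  show ?thesis
    using left_moduleD(3)[OF assms(1)] assms(2)
    by (intro M.add_idem_zero) (auto simp flip: left_moduleD(4)[OF assms(1)])
qed

lemma left_module_minus_one:
  assumes "left_module A M" "x \<in> carrier M"
  shows "(\<ominus>\<^bsub>A\<^esub> \<one>\<^bsub>A\<^esub>) \<odot>\<^bsub>M\<^esub> x = \<ominus>\<^bsub>M\<^esub> x"
proof -
  interpret A: ring A using left_moduleD(1)[OF assms(1)] .
  interpret M: abelian_group M using left_moduleD(2)[OF assms(1)] .
  have "(\<ominus>\<^bsub>A\<^esub> \<one>\<^bsub>A\<^esub>) \<odot>\<^bsub>M\<^esub> x \<oplus>\<^bsub>M\<^esub> x = \<zero>\<^bsub>M\<^esub>"
    using left_moduleD(4)[OF assms(1), of "\<ominus>\<^bsub>A\<^esub> \<one>\<^bsub>A\<^esub>" "\<one>\<^bsub>A\<^esub>" x] assms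
    by (simp add: A.l_neg left_module_zero_smult left_moduleD(7))
  then show ?thesis
    using M.minus_equality[of "(\<ominus>\<^bsub>A\<^esub> \<one>\<^bsub>A\<^esub>) \<odot>\<^bsub>M\<^esub> x" x] assms left_moduleD(3)[OF assms(1)] by auto
qed

lemma left_submoduleI:
  assumes M: "left_module A M" and "W \<subseteq> carrier M" "\<zero>\<^bsub>M\<^esub> \<in> W"
    and "\<And>x y. x \<in> W \<Longrightarrow> y \<in> W \<Longrightarrow> x \<oplus>\<^bsub>M\<^esub> y \<in> W"
    and sm: "\<And>a x. a \<in> carrier A \<Longrightarrow> x \<in> W \<Longrightarrow> a \<odot>\<^bsub>M\<^esub> x \<in> W"
  shows "left_submodule A W M"
proof -
  interpret A: ring A using left_moduleD(1)[OF M] .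
  interpret M: abelian_group M using left_moduleD(2)[OF M] .
  have "\<ominus>\<^bsub>M\<^esub> x \<in> W" if "x \<in> W" for x
    using sm[of "\<ominus>\<^bsub>A\<^esub> \<one>\<^bsub>A\<^esub>" x] left_module_minus_one[OF M, of x] that assms(2) by auto
  then have "subgroup W (add_monoid M)"
    using assms by (intro M.add.subgroupI) auto
  then show ?thesis using sm by (simp add: left_submodule_def)
qed

lemma left_submoduleD:
  assumes "left_submodule A W M"
  shows "W \<subseteq> carrier M" "\<zero>\<^bsub>M\<^esub> \<in> W"
    and "x \<in> W \<Longrightarrow> y \<in> W \<Longrightarrow> x \<oplus>\<^bsub>M\<^esub> y \<in> W"
    and "a \<in> carrier A \<Longrightarrow> x \<in> W \<Longrightarrow> a \<odot>\<^bsub>M\<^esub> x \<in> W"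
  using assms subgroup.subset[of W "add_monoid M"] subgroup.one_closed[of W "add_monoid M"]
    subgroup.m_closed[of W "add_monoid M"]
  by (auto simp: left_submodule_def)

lemma irreducibleD:
  assumes "irreducible_module A M"
  shows "left_module A M" "carrier M \<noteq> {\<zero>\<^bsub>M\<^esub>}"
    and "left_submodule A W M \<Longrightarrow> W \<noteq> {\<zero>\<^bsub>M\<^esub>} \<Longrightarrow> W = carrier M"
  using assms by (auto simp: irreducible_module_def)

lemma irreducible_nonzero:
  assumes "irreducible_module A M" obtains v where "v \<in> carrier M" "v \<noteq> \<zero>\<^bsub>M\<^esub>"
proof -
  interpret M: abelian_group M using left_moduleD(2)[OF irreducibleD(1)[OF assms]] .
  show ?thesis using irreducibleD(2)[OF assms] that M.zero_closed by blast
qed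

lemma module_homD:
  assumes "f \<in> LinearCombinations.module_hom A M N"
  shows "x \<in> carrier M \<Longrightarrow> f x \<in> carrier N"
    and "x \<in> carrier M \<Longrightarrow> y \<in> carrier M \<Longrightarrow> f (x \<oplus>\<^bsub>M\<^esub> y) = f x \<oplus>\<^bsub>N\<^esub> f y"
    and "a \<in> carrier A \<Longrightarrow> x \<in> carrier M \<Longrightarrow> f (a \<odot>\<^bsub>M\<^esub> x) = a \<odot>\<^bsub>N\<^esub> f x"
  using assms by (auto simp: LinearCombinations.module_hom_def)

lemma module_homI:
  assumes "\<And>x. x \<in> carrier M \<Longrightarrow> f x \<in> carrier N"
    and "\<And>x y. x \<in> carrier M \<Longrightarrow> y \<in> carrier M \<Longrightarrow> f (x \<oplus>\<^bsub>M\<^esub> y) = f x \<oplus>\<^bsub>N\<^esub> f y"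
    and "\<And>a x. a \<in> carrier A \<Longrightarrow> x \<in> carrier M \<Longrightarrow> f (a \<odot>\<^bsub>M\<^esub> x) = a \<odot>\<^bsub>N\<^esub> f x"
  shows "f \<in> LinearCombinations.module_hom A M N"
  using assms by (auto simp: LinearCombinations.module_hom_def)

lemma additive_zero:
  assumes "abelian_group M" "abelian_group N"
    and "\<And>x. x \<in> carrier M \<Longrightarrow> f x \<in> carrier N"
    and "\<And>x y. x \<in> carrier M \<Longrightarrow> y \<in> carrier M \<Longrightarrow> f (x \<oplus>\<^bsub>M\<^esub> y) = f x \<oplus>\<^bsub>N\<^esub> f y"
  shows "f \<zero>\<^bsub>M\<^esub> = \<zero>\<^bsub>N\<^esub>"
proof -
  interpret M: abelian_group M by fact
  interpret N: abelian_group N by fact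
  show ?thesis using assms(3) by (intro N.add_idem_zero) (auto simp flip: assms(4))
qed

lemma module_hom_zero:
  assumes "abelian_group M" "abelian_group N" "f \<in> LinearCombinations.module_hom A M N"
  shows "f \<zero>\<^bsub>M\<^esub> = \<zero>\<^bsub>N\<^esub>"
  by (rule additive_zero[OF assms(1,2)]) (auto simp: module_homD[OF assms(3)])

lemma module_isomorphic_refl: "module_isomorphic A M M"
  unfolding module_isomorphic_def by (rule bexI[of _ id]) (auto intro: module_homI)

lemma module_isomorphic_trans:
  assumes "module_isomorphic A M N" "module_isomorphic A N P" shows "module_isomorphic A M P"
proof -
  obtain f g where f: "f \<in> LinearCombinations.module_hom A M N" "bij_betw f (carrier M) (carrier N)"
    and g: "g \<in> LinearCombinations.module_hom A N P" "bij_betw g (carrier N) (carrier P)"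
    using assms by (auto simp: module_isomorphic_def)
  have "g \<circ> f \<in> LinearCombinations.module_hom A M P"
    using module_homD[OF f(1)] module_homD[OF g(1)] by (intro module_homI) auto
  then show ?thesis using bij_betw_trans[OF f(2) g(2)] by (auto simp: module_isomorphic_def)
qed

lemma module_isomorphic_sym:
  assumes "left_module A M" "module_isomorphic A M N" shows "module_isomorphic A N M"
proof -
  interpret M: abelian_group M using left_moduleD(2)[OF assms(1)] .
  obtain f where f: "f \<in> LinearCombinations.module_hom A M N" "bij_betw f (carrier M) (carrier N)"
    using assms by (auto simp: module_isomorphic_def)
  let ?g = "inv_into (carrier M) f"
  have g: "bij_betw ?g (carrier N) (carrier M)" using f(2) by (rule bij_betw_inv_into)
  have gc: "?g y \<in> carrier M" "f (?g y) = y" if "y \<in> carrier N" for y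
    using that f(2) g bij_betw_inv_into_right[OF f(2)] by (auto simp: bij_betw_def)
  have gf: "?g (f x) = x" if "x \<in> carrier M" for x
    using bij_betw_inv_into_left[OF f(2) that] .
  have "?g \<in> LinearCombinations.module_hom A N M"
  proof (rule module_homI)
    fix x y assume "x \<in> carrier N" "y \<in> carrier N"
    then show "?g (x \<oplus>\<^bsub>N\<^esub> y) = ?g x \<oplus>\<^bsub>M\<^esub> ?g y"
      using module_homD(2)[OF f(1), of "?g x" "?g y"] gf[of "?g x \<oplus>\<^bsub>M\<^esub> ?g y"] gc by auto
  next
    fix a x assume "a \<in> carrier A" "x \<in> carrier N"
    then show "?g (a \<odot>\<^bsub>N\<^esub> x) = a \<odot>\<^bsub>M\<^esub> ?g x"
      using module_homD(3)[OF f(1), of a "?g x"] gf[of "a \<odot>\<^bsub>M\<^esub> ?g x"] gc left_moduleD(3)[OF assms(1)]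
      by auto
  qed (use gc in auto)
  then show ?thesis using g by (auto simp: module_isomorphic_def)
qed

text \<open>Schur's lemma: the kernel and the image are submodules, hence trivial.\<close>

lemma irreducible_hom_bij:
  assumes M: "irreducible_module A M" and N: "irreducible_module A N"
    and f: "f \<in> LinearCombinations.module_hom A M N" and v: "v \<in> carrier M" "f v \<noteq> \<zero>\<^bsub>N\<^esub>"
  shows "bij_betw f (carrier M) (carrier N)"
proof -
  note lM = irreducibleD(1)[OF M] and lN = irreducibleD(1)[OF N]
  interpret M: abelian_group M using left_moduleD(2)[OF lM] .
  interpret N: abelian_group N using left_moduleD(2)[OF lN] .
  have f0: "f \<zero>\<^bsub>M\<^esub> = \<zero>\<^bsub>N\<^esub>"
    using module_hom_zero[OF M.abelian_group_axioms N.abelian_group_axioms f] .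
  have "left_submodule A (f ` carrier M) N"
  proof (rule left_submoduleI[OF lN])
    show "\<zero>\<^bsub>N\<^esub> \<in> f ` carrier M" using f0 by force
  next
    fix x y assume "x \<in> f ` carrier M" "y \<in> f ` carrier M"
    then obtain x' y' where xy': "x' \<in> carrier M" "y' \<in> carrier M" "x = f x'" "y = f y'" by auto
    then have "x \<oplus>\<^bsub>N\<^esub> y = f (x' \<oplus>\<^bsub>M\<^esub> y')" using module_homD(2)[OF f] by simp
    then show "x \<oplus>\<^bsub>N\<^esub> y \<in> f ` carrier M" using M.a_closed[OF xy'(1,2)] by blast
  next
    fix a x assume a: "a \<in> carrier A" and "x \<in> f ` carrier M"
    then obtain x' where x': "x' \<in> carrier M" "x = f x'" by auto
    then have "a \<odot>\<^bsub>N\<^esub> x = f (a \<odot>\<^bsub>M\<^esub> x')" using module_homD(3)[OF f a] by simp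
    then show "a \<odot>\<^bsub>N\<^esub> x \<in> f ` carrier M" using left_moduleD(3)[OF lM a x'(1)] by blast
  qed (use module_homD(1)[OF f] in auto)
  then have im: "f ` carrier M = carrier N"
    using irreducibleD(3)[OF N] v by blast
  have "left_submodule A {x \<in> carrier M. f x = \<zero>\<^bsub>N\<^esub>} M"
    by (rule left_submoduleI[OF lM])
      (auto simp: f0 module_homD[OF f] left_moduleD(3)[OF lM] left_module_smult_zero[OF lN])
  then have ker: "x = \<zero>\<^bsub>M\<^esub>" if "x \<in> carrier M" "f x = \<zero>\<^bsub>N\<^esub>" for x
    using irreducibleD(3)[OF M, of "{x \<in> carrier M. f x = \<zero>\<^bsub>N\<^esub>}"] v that by blast
  have "inj_on f (carrier M)"
  proof (rule inj_onI)
    fix x y assume xy: "x \<in> carrier M" "y \<in> carrier M" "f x = f y"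
    have "f (x \<oplus>\<^bsub>M\<^esub> \<ominus>\<^bsub>M\<^esub> y) = f (y \<oplus>\<^bsub>M\<^esub> \<ominus>\<^bsub>M\<^esub> y)"
      using xy module_homD(2)[OF f] by auto
    also have "\<dots> = \<zero>\<^bsub>N\<^esub>" using xy f0 by (simp add: M.r_neg)
    finally have "x \<oplus>\<^bsub>M\<^esub> \<ominus>\<^bsub>M\<^esub> y = \<zero>\<^bsub>M\<^esub>" using ker xy by simp
    then show "x = y" using xy M.minus_equality[of x "\<ominus>\<^bsub>M\<^esub> y"] by simp
  qed
  then show ?thesis using im by (simp add: bij_betw_def)
qed

section \<open>The blocks of a split semisimple algebra\<close>

definition mat_unit :: "nat \<Rightarrow> nat \<Rightarrow> nat \<Rightarrow> 'k::field mat" where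
  "mat_unit d a b = mat d d (\<lambda>(i, j). if i = a \<and> j = b then 1 else 0)"

lemma mat_unit_carrier [simp]: "mat_unit d a b \<in> carrier_mat d d"
  by (simp add: mat_unit_def)

lemma mat_unit_dim [simp]: "dim_row (mat_unit d a b) = d" "dim_col (mat_unit d a b) = d"
  by (simp_all add: mat_unit_def)

lemma mat_unit_times:
  assumes "X \<in> carrier_mat d d" "i < d" "j < d" "b < d"
  shows "(mat_unit d a b * X) $$ (i, j) = (if i = a then X $$ (b, j) else 0)"
proof -
  have "(mat_unit d a b * X) $$ (i, j) = (\<Sum>k\<in>{0..<d}. (if i = a \<and> k = b then 1 else 0) * X $$ (k, j))"
    using assms by (auto simp: scalar_prod_def mat_unit_def intro!: sum.cong)
  also have "\<dots> = (\<Sum>k\<in>{0..<d}. if k = b then (if i = a then X $$ (k, j) else 0) else 0)"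
    by (rule sum.cong) auto
  finally show ?thesis using assms by simp
qed

lemma times_mat_unit:
  assumes "X \<in> carrier_mat d d" "i < d" "j < d" "a < d"
  shows "(X * mat_unit d a b) $$ (i, j) = (if j = b then X $$ (i, a) else 0)"
proof -
  have "(X * mat_unit d a b) $$ (i, j) = (\<Sum>k\<in>{0..<d}. X $$ (i, k) * (if k = a \<and> j = b then 1 else 0))"
    using assms by (auto simp: scalar_prod_def mat_unit_def intro!: sum.cong)
  also have "\<dots> = (\<Sum>k\<in>{0..<d}. if k = a then (if j = b then X $$ (i, k) else 0) else 0)"
    by (rule sum.cong) auto
  finally show ?thesis using assms by simp
qed

lemma mat_unit_corner:
  assumes "X \<in> carrier_mat d d" "a < d" "b < d"
  shows "mat_unit d c a * X * mat_unit d b e = X $$ (a, b) \<cdot>\<^sub>m mat_unit d c e"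
proof (rule eq_matI)
  fix i j assume "i < dim_row (X $$ (a, b) \<cdot>\<^sub>m mat_unit d c e)" "j < dim_col (X $$ (a, b) \<cdot>\<^sub>m mat_unit d c e)"
  then have "i < d" "j < d" by auto
  then show "(mat_unit d c a * X * mat_unit d b e) $$ (i, j) = (X $$ (a, b) \<cdot>\<^sub>m mat_unit d c e) $$ (i, j)"
    using assms times_mat_unit[OF mult_carrier_mat[OF mat_unit_carrier assms(1)], of i j b c a e]
      mat_unit_times[OF assms(1), of i b a c]
    by (simp add: mat_unit_def)
qed (use assms in auto)

lemma mat_unit_mult: "b < d \<Longrightarrow> mat_unit d a b * mat_unit d b c = mat_unit d a c"
  by (rule eq_matI) (auto simp: mat_unit_times[where d = d] simp del: index_mult_mat(1), auto simp: mat_unit_def)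

lemma mat_unit_nonzero: "a < d \<Longrightarrow> b < d \<Longrightarrow> (mat_unit d a b :: 'k::field mat) \<noteq> 0\<^sub>m d d"
  by (auto simp: mat_unit_def mat_eq_iff)

lemma central_matrix_scalar:
  assumes X: "X \<in> carrier_mat d d"
    and comm: "\<And>Y. Y \<in> carrier_mat d d \<Longrightarrow> X * Y = Y * (X :: 'k::field mat)"
    and "0 < d"
  shows "X = X $$ (0, 0) \<cdot>\<^sub>m 1\<^sub>m d"
proof (rule eq_matI)
  fix i j assume "i < dim_row (X $$ (0, 0) \<cdot>\<^sub>m 1\<^sub>m d)" "j < dim_col (X $$ (0, 0) \<cdot>\<^sub>m 1\<^sub>m d)"
  then have ij: "i < d" "j < d" by auto
  \<comment> \<open>Compare the entries \<open>(i, 0)\<close> of both products with the matrix unit \<open>E\<^sub>j\<^sub>0\<close>.\<close>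
  have "X $$ (i, j) = (X * mat_unit d j 0) $$ (i, 0)"
    using times_mat_unit[OF X, of i 0 j 0] ij assms(3) by simp
  also have "\<dots> = (mat_unit d j 0 * X) $$ (i, 0)" using comm by simp
  also have "\<dots> = (if i = j then X $$ (0, 0) else 0)"
    using mat_unit_times[OF X, of i 0 0 j] ij assms(3) by simp
  finally show "X $$ (i, j) = (X $$ (0, 0) \<cdot>\<^sub>m 1\<^sub>m d) $$ (i, j)" using ij by simp
qed (use assms in auto)

text \<open>The properties of a direct sum of matrix algebras on which the representation theory below rests.
  Here \<open>e i\<close> is the identity of the \<open>i\<close>-th block and \<open>p i\<close> an idempotent of rank one in it.  That the
  algebra is split enters through \<open>centre_block\<close> and \<open>corner\<close>, where scalars of the ground field
  suffice; \<open>ideal_block\<close> expresses that the block is simple.\<close>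

locale block_algebra = algebra_over A for A :: "('k::field, 'a) module" (structure) +
  fixes r :: nat and e p :: "nat \<Rightarrow> 'a"
  assumes e_centre: "i < r \<Longrightarrow> e i \<in> centre A"
    and e_mult: "i < r \<Longrightarrow> j < r \<Longrightarrow> e i \<otimes> e j = (if i = j then e i else \<zero>)"
    and detect_zero: "x \<in> carrier A \<Longrightarrow> (\<And>i. i < r \<Longrightarrow> e i \<otimes> x = \<zero>) \<Longrightarrow> x = \<zero>"
    and centre_block: "z \<in> centre A \<Longrightarrow> i < r \<Longrightarrow> \<exists>c. z \<otimes> e i = c \<odot> e i"
    and p_closed: "i < r \<Longrightarrow> p i \<in> carrier A"
    and p_nonzero: "i < r \<Longrightarrow> p i \<noteq> \<zero>"
    and p_block: "i < r \<Longrightarrow> e i \<otimes> p i = p i"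
    and p_idem: "i < r \<Longrightarrow> p i \<otimes> p i = p i"
    and corner: "i < r \<Longrightarrow> x \<in> carrier A \<Longrightarrow> \<exists>c. p i \<otimes> x \<otimes> p i = c \<odot> p i"
    and ideal_block: "i < r \<Longrightarrow> ideal I A \<Longrightarrow> p i \<in> I \<Longrightarrow> e i \<in> I"

text \<open>Take for \<open>p i\<close> the matrix unit \<open>E\<^sub>0\<^sub>0\<close> of the \<open>i\<close>-th block.  An ideal that contains it contains all
  \<open>E\<^sub>k\<^sub>k = E\<^sub>k\<^sub>0 E\<^sub>0\<^sub>0 E\<^sub>0\<^sub>k\<close> and therefore the identity matrix of the block.\<close>

lemma split_semisimple_blocks:
  fixes A :: "('k::field, 'a) module" (structure)
  assumes "split_semisimple A"
  obtains r e p where "block_algebra A r e p"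
proof -
  interpret algebra_over A using assms by (auto intro: algebra_overI simp: split_semisimple_def)
  obtain r :: nat and d f where d: "\<And>i. i < r \<Longrightarrow> d i \<ge> 1"
    and f: "f \<in> algebra_hom A (family_sum {..<r} (\<lambda>i. module_mat TYPE('k) (d i) (d i)))"
    and bij: "bij_betw f (carrier A) (carrier (family_sum {..<r} (\<lambda>i. module_mat TYPE('k) (d i) (d i))))"
    using assms unfolding split_semisimple_def algebra_isomorphic_def by blast
  let ?F = "family_sum {..<r} (\<lambda>i. module_mat TYPE('k) (d i) (d i))"
  have F: "carrier ?F = (\<Pi>\<^sub>E i\<in>{..<r}. carrier_mat (d i) (d i))" by (simp add: family_sum_def module_mat_def)
  have fc: "f x i \<in> carrier_mat (d i) (d i)" if "x \<in> carrier A" "i < r" for x i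
    using algebra_homD(1)[OF f that(1)] that(2) by (auto simp: F PiE_iff)
  have fmul: "f (x \<otimes>\<^bsub>A\<^esub> y) i = f x i * f y i" if "x \<in> carrier A" "y \<in> carrier A" "i < r" for x y i
    using algebra_homD(2)[OF f that(1,2)] that(3) by (simp add: family_sum_def module_mat_def)
  have fadd: "f (x \<oplus>\<^bsub>A\<^esub> y) i = f x i + f y i" if "x \<in> carrier A" "y \<in> carrier A" "i < r" for x y i
    using algebra_homD(3)[OF f that(1,2)] that(3) by (simp add: family_sum_def module_mat_def)
  have fscale: "f (c \<odot>\<^bsub>A\<^esub> x) i = c \<cdot>\<^sub>m f x i" if "x \<in> carrier A" "i < r" for c x i
    using algebra_homD(5)[OF f that(1)] that(2) by (simp add: family_sum_def module_mat_def)
  have fone: "f \<one>\<^bsub>A\<^esub> i = 1\<^sub>m (d i)" if "i < r" for i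
    using algebra_homD(4)[OF f] that by (simp add: family_sum_def module_mat_def)
  have feq: "x = y" if "x \<in> carrier A" "y \<in> carrier A" "\<And>i. i < r \<Longrightarrow> f x i = f y i" for x y
  proof -
    have "f x = f y"
      using algebra_homD(1)[OF f that(1)] algebra_homD(1)[OF f that(2)] that(3)
      unfolding F by (intro PiE_ext) auto
    then show ?thesis using bij that(1,2) by (auto simp: bij_betw_def inj_on_def)
  qed
  have fzero: "f \<zero>\<^bsub>A\<^esub> i = 0\<^sub>m (d i) (d i)" if "i < r" for i
  proof -
    have "f \<zero> i = 0 \<cdot>\<^sub>m f \<zero> i" using fscale[of "\<zero>" i 0] that by simp
    also have "\<dots> = 0\<^sub>m (d i) (d i)" using fc[of "\<zero>" i] that by (intro eq_matI) auto
    finally show ?thesis .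
  qed
  \<comment> \<open>\<open>s i M\<close> is the element of \<open>A\<close> with the matrix \<open>M\<close> in block \<open>i\<close> and zero elsewhere.\<close>
  define s where "s i M = inv_into (carrier A) f (\<lambda>j\<in>{..<r}. if j = i then M else 0\<^sub>m (d j) (d j))" for i M
  have s: "s i M \<in> carrier A" "\<And>j. j < r \<Longrightarrow> f (s i M) j = (if j = i then M else 0\<^sub>m (d j) (d j))"
    if "M \<in> carrier_mat (d i) (d i)" for i M
  proof -
    have "(\<lambda>j\<in>{..<r}. if j = i then M else 0\<^sub>m (d j) (d j)) \<in> carrier ?F" using that by (auto simp: F)
    then have "(\<lambda>j\<in>{..<r}. if j = i then M else 0\<^sub>m (d j) (d j)) \<in> f ` carrier A"
      using bij by (auto simp: bij_betw_def)
    then show "s i M \<in> carrier A" "\<And>j. j < r \<Longrightarrow> f (s i M) j = (if j = i then M else 0\<^sub>m (d j) (d j))"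
      by (simp_all add: s_def f_inv_into_f inv_into_into)
  qed
  have sl: "s i M \<otimes>\<^bsub>A\<^esub> x = s i (M * f x i)"
    if "M \<in> carrier_mat (d i) (d i)" "x \<in> carrier A" "i < r" for i M x
    using that by (intro feq) (auto simp: s fmul intro: fc mult_carrier_mat, auto simp: s fmul fc mult_carrier_mat[OF _ fc] left_mult_zero_mat[OF fc])
  have sr: "x \<otimes>\<^bsub>A\<^esub> s i M = s i (f x i * M)"
    if "M \<in> carrier_mat (d i) (d i)" "x \<in> carrier A" "i < r" for i M x
    using that by (intro feq) (auto simp: s fmul intro: fc mult_carrier_mat, auto simp: s fmul fc mult_carrier_mat[OF fc] right_mult_zero_mat[OF fc])
  have ss: "s i M \<otimes>\<^bsub>A\<^esub> s i N = s i (M * N)"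
    if "M \<in> carrier_mat (d i) (d i)" "N \<in> carrier_mat (d i) (d i)" "i < r" for i M N
    using sl[OF that(1) s(1)[OF that(2)]] s(2)[OF that(2,3)] that(3) by simp
  have sscale: "c \<odot>\<^bsub>A\<^esub> s i M = s i (c \<cdot>\<^sub>m M)" if "M \<in> carrier_mat (d i) (d i)" "i < r" for c i M
    using that by (intro feq) (auto simp: s fscale)
  have sadd: "s i M \<oplus>\<^bsub>A\<^esub> s i N = s i (M + N)"
    if "M \<in> carrier_mat (d i) (d i)" "N \<in> carrier_mat (d i) (d i)" "i < r" for i M N
    using that by (intro feq) (auto simp: s fadd)
  have s0: "s i (0\<^sub>m (d i) (d i)) = \<zero>" if "i < r" for i
    using that by (intro feq) (auto simp: s fzero)
  define e where "e i = s i (1\<^sub>m (d i))" for i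
  define p where "p i = s i (mat_unit (d i) 0 0)" for i
  have ec: "e i \<in> carrier A" for i by (simp add: e_def s)
  have e_left: "e i \<otimes> x = s i (f x i)" and e_right: "x \<otimes> e i = s i (f x i)" if "x \<in> carrier A" "i < r" for x i
    using that fc[OF that] by (simp_all add: e_def sl sr)
  have "block_algebra A r e p"
  proof (intro block_algebra.intro block_algebra_axioms.intro algebra_over_axioms, goal_cases)
    case (1 i)
    have "e i \<otimes> x = x \<otimes> e i" if "x \<in> carrier A" for x
      using e_left[OF that 1] e_right[OF that 1] by simp
    then show ?case unfolding centre_def using ec by blast
  next
    case (2 i j)
    then show ?case using e_left[OF ec[of j], of i] by (auto simp: e_def s s0)
  next
    case (3 x)
    show ?case
    proof (rule feq)
      fix i assume "i < r"
      then have "s i (f x i) = \<zero>" using 3 e_left by simp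
      then have "f (s i (f x i)) i = 0\<^sub>m (d i) (d i)" using fzero[OF \<open>i < r\<close>] by simp
      then show "f x i = f \<zero> i" using \<open>i < r\<close> fc 3 by (simp add: s fzero)
    qed (use 3 in auto)
  next
    case (4 z i)
    then have z: "z \<in> carrier A" by simp
    have "f z i = f z i $$ (0, 0) \<cdot>\<^sub>m 1\<^sub>m (d i)"
    proof (rule central_matrix_scalar)
      fix Y :: "'k mat" assume Y: "Y \<in> carrier_mat (d i) (d i)"
      have "f (z \<otimes> s i Y) i = f (s i Y \<otimes> z) i" using centre_commutes[OF 4(1)] s(1)[OF Y] by simp
      then show "f z i * Y = Y * f z i" using 4 z s[OF Y] by (simp add: fmul)
    qed (use fc[OF z] d[of i] 4 in auto)
    then have "z \<otimes> e i = s i (f z i $$ (0, 0) \<cdot>\<^sub>m 1\<^sub>m (d i))" using e_right[OF z] 4 by simp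
    also have "\<dots> = f z i $$ (0, 0) \<odot> e i" using 4 by (simp add: e_def sscale)
    finally show ?case by blast
  next
    case (5 i)
    then show ?case by (simp add: p_def s)
  next
    case (6 i)
    have "f (p i) i \<noteq> f \<zero> i"
      using 6 d[of i] mat_unit_nonzero[of 0 "d i" 0] by (simp add: p_def s fzero)
    then show ?case by metis
  next
    case (7 i)
    then show ?case by (simp add: p_def e_def s ss)
  next
    case (8 i)
    then show ?case using d[of i] by (simp add: p_def s ss mat_unit_mult)
  next
    case (9 i x)
    then have "p i \<otimes> x \<otimes> p i = s i (mat_unit (d i) 0 0 * f x i * mat_unit (d i) 0 0)"
      using fc[of x i] by (simp add: p_def sl s ss mult_carrier_mat[OF _ fc])
    also have "\<dots> = f x i $$ (0, 0) \<odot> p i"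
      using 9 d[of i] by (simp add: mat_unit_corner[OF fc] p_def sscale)
    finally show ?case by blast
  next
    case (10 i I)
    interpret I: ideal I A by fact
    \<comment> \<open>The partial sums of the diagonal matrix units lie in the ideal.\<close>
    have "s i (mat (d i) (d i) (\<lambda>(a, b). if a = b \<and> a < k then 1 else 0)) \<in> I" if "k \<le> d i" for k
      using that
    proof (induction k)
      case 0
      have "mat (d i) (d i) (\<lambda>(a, b). if a = b \<and> a < (0::nat) then 1 else 0) = (0\<^sub>m (d i) (d i) :: 'k mat)"
        by (rule eq_matI) auto
      then show ?case by (simp only: s0[OF 10(1)] additive_subgroup.zero_closed[OF I.additive_subgroup_axioms])
    next
      case (Suc k)
      let ?E = "mat_unit (d i) :: nat \<Rightarrow> nat \<Rightarrow> 'k mat"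
      have "s i (?E k 0) \<otimes> p i \<otimes> s i (?E 0 k) = s i (?E k k)"
        using 10 Suc by (simp add: p_def ss s mat_unit_mult mult_carrier_mat)
      moreover have "s i (?E k 0) \<otimes> p i \<otimes> s i (?E 0 k) \<in> I"
        using 10 by (intro I.I_r_closed I.I_l_closed s) auto
      moreover have "mat (d i) (d i) (\<lambda>(a, b). if a = b \<and> a < Suc k then 1 else 0)
        = mat (d i) (d i) (\<lambda>(a, b). if a = b \<and> a < k then 1 else 0) + ?E k k"
        by (rule eq_matI) (auto simp: mat_unit_def)
      ultimately show ?case using Suc 10 by (simp only: sadd[symmetric] mat_unit_carrier mat_carrier) simp
    qed
    from this[of "d i"] have "s i (mat (d i) (d i) (\<lambda>(a, b). if a = b \<and> a < d i then 1 else 0)) \<in> I" by simp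
    moreover have "mat (d i) (d i) (\<lambda>(a, b). if a = b \<and> a < d i then 1 else 0) = (1\<^sub>m (d i) :: 'k mat)"
      by (rule eq_matI) auto
    ultimately show ?case by (simp add: e_def)
  qed
  then show thesis by (rule that)
qed

section \<open>Irreducible modules and primitive central idempotents\<close>

lemma (in abelian_monoid) finsum_mem:
  assumes "finite S" "K \<subseteq> carrier G" "\<zero> \<in> K" "\<And>x y. x \<in> K \<Longrightarrow> y \<in> K \<Longrightarrow> x \<oplus> y \<in> K"
    and "\<And>i. i \<in> S \<Longrightarrow> f i \<in> K"
  shows "(\<Oplus>i\<in>S. f i) \<in> K"
  using assms(1,5)
proof (induction S rule: finite_induct)
  case (insert i S)
  then have "f \<in> S \<rightarrow> carrier G" "f i \<in> carrier G" using assms(2) by auto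
  then show ?case using insert assms(4) by simp
qed (simp add: assms(3))

text \<open>The difference of \<open>1\<close> and the sum is annihilated by every member of the family.\<close>

lemma (in ring) sum_one_if_detecting:
  assumes "finite S" and E: "\<And>s. s \<in> S \<Longrightarrow> E s \<in> carrier R"
    and orth: "\<And>s t. s \<in> S \<Longrightarrow> t \<in> S \<Longrightarrow> E s \<otimes> E t = (if s = t then E s else \<zero>)"
    and detect: "\<And>x. x \<in> carrier R \<Longrightarrow> (\<And>s. s \<in> S \<Longrightarrow> x \<otimes> E s = \<zero>) \<Longrightarrow> x = \<zero>"
  shows "(\<Oplus>s\<in>S. E s) = \<one>"
proof -
  have Ef: "E \<in> S \<rightarrow> carrier R" using E by auto
  have "\<one> \<ominus> (\<Oplus>s\<in>S. E s) = \<zero>"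
  proof (rule detect)
    fix t assume t: "t \<in> S"
    have "(\<Oplus>s\<in>S. E s) \<otimes> E t = (\<Oplus>s\<in>S. E s \<otimes> E t)" using finsum_ldistr[OF assms(1) E[OF t] Ef] .
    also have "\<dots> = (\<Oplus>s\<in>S. if t = s then E s else \<zero>)" using t E by (intro finsum_cong') (auto simp: orth)
    also have "\<dots> = E t" using finsum_singleton[OF t assms(1) Ef] .
    finally show "(\<one> \<ominus> (\<Oplus>s\<in>S. E s)) \<otimes> E t = \<zero>"
      using E[OF t] Ef by (simp add: minus_eq l_distr l_minus r_neg)
  qed (use Ef in auto)
  then show ?thesis using Ef by (metis finsum_closed one_closed r_right_minus_eq)
qed

lemma (in ring) detecting_if_sum_one:
  assumes "finite S" "\<And>s. s \<in> S \<Longrightarrow> E s \<in> carrier R" "(\<Oplus>s\<in>S. E s) = \<one>" "x \<in> carrier R"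
    and "\<And>s. s \<in> S \<Longrightarrow> x \<otimes> E s = \<zero>"
  shows "x = \<zero>"
proof -
  have "x = x \<otimes> (\<Oplus>s\<in>S. E s)" using assms by simp
  also have "\<dots> = (\<Oplus>s\<in>S. x \<otimes> E s)" using assms by (intro finsum_rdistr) auto
  also have "\<dots> = (\<Oplus>s\<in>S. \<zero>)" using assms by (intro finsum_cong') auto
  finally show ?thesis by simp
qed

context block_algebra
begin

lemma e_closed [simp, intro]: "i < r \<Longrightarrow> e i \<in> carrier A"
  using e_centre by simp

lemma e_nonzero: "i < r \<Longrightarrow> e i \<noteq> \<zero>"
  using p_block[of i] p_nonzero[of i] p_closed[of i] by auto

lemma e_sum: "(\<Oplus>i\<in>{..<r}. e i) = \<one>"
proof (rule sum_one_if_detecting)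
  fix x assume "x \<in> carrier A" "\<And>i. i \<in> {..<r} \<Longrightarrow> x \<otimes> e i = \<zero>"
  then show "x = \<zero>" by - (rule detect_zero, simp_all add: centre_commutes[OF e_centre])
qed (simp_all add: e_mult)

text \<open>The left ideal \<open>A p i\<close> as a left module.  Its elements are those fixed by right multiplication with
  the idempotent \<open>p i\<close>; as matrices, those supported on the first column of the block.\<close>

definition column :: "nat \<Rightarrow> ('a, 'a) module" where
  "column i = \<lparr>carrier = {y \<in> carrier A. y \<otimes> p i = y}, mult = mult A, one = one A, zero = zero A,
     add = add A, smult = mult A\<rparr>"

lemma column_simps [simp]:
  "carrier (column i) = {y \<in> carrier A. y \<otimes> p i = y}" "add (column i) = add A"
  "zero (column i) = zero A" "smult (column i) = mult A"
  by (simp_all add: column_def)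

lemma left_module_column: assumes "i < r" shows "left_module A (column i)"
proof -
  note pc = p_closed[OF assms]
  have "abelian_group (column i)"
  proof (rule abelian_groupI)
    fix x assume "x \<in> carrier (column i)"
    then have "\<ominus> x \<in> carrier (column i)" "\<ominus> x \<oplus>\<^bsub>column i\<^esub> x = \<zero>\<^bsub>column i\<^esub>"
      using pc by (auto simp: l_minus l_neg)
    then show "\<exists>y\<in>carrier (column i). y \<oplus>\<^bsub>column i\<^esub> x = \<zero>\<^bsub>column i\<^esub>" by blast
  qed (use pc in \<open>auto simp: l_distr a_assoc a_comm a_lcomm\<close>)
  then show ?thesis
    using pc by (intro left_module.intro left_module_axioms.intro ring_axioms)
      (auto simp: m_assoc l_distr r_distr)
qed

text \<open>The elements \<open>y\<close> with \<open>y A w = 0\<close> form a two-sided ideal.  It does not contain \<open>e i\<close>, hence does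
  not contain \<open>p i\<close>.\<close>

lemma exists_product_nonzero:
  assumes "i < r" "w \<in> carrier A" "e i \<otimes> w \<noteq> \<zero>"
  obtains x where "x \<in> carrier A" "p i \<otimes> x \<otimes> w \<noteq> \<zero>"
proof -
  let ?K = "{y \<in> carrier A. \<forall>x\<in>carrier A. y \<otimes> x \<otimes> w = \<zero>}"
  have "ideal ?K A"
  proof (rule idealI)
    show "subgroup ?K (add_monoid A)"
      using assms(2) by (intro add.subgroupI) (auto simp: l_distr l_minus simp flip: a_inv_def)
    fix a x assume a: "a \<in> ?K" and x: "x \<in> carrier A"
    have "a \<otimes> x \<otimes> y \<otimes> w = \<zero>" "x \<otimes> a \<otimes> y \<otimes> w = \<zero>" if y: "y \<in> carrier A" for y
    proof -
      have "a \<otimes> x \<otimes> y \<otimes> w = a \<otimes> (x \<otimes> y) \<otimes> w" using a x y by (auto simp: m_assoc)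
      then show "a \<otimes> x \<otimes> y \<otimes> w = \<zero>" using a x y by auto
      have "x \<otimes> a \<otimes> y \<otimes> w = x \<otimes> (a \<otimes> y \<otimes> w)" using a x y assms(2) by (auto simp: m_assoc)
      then show "x \<otimes> a \<otimes> y \<otimes> w = \<zero>" using a x y by auto
    qed
    then show "x \<otimes> a \<in> ?K" "a \<otimes> x \<in> ?K" using a x by auto
  qed (rule ring_axioms)
  moreover have "e i \<notin> ?K" using assms by (auto intro!: bexI[of _ \<one>])
  ultimately have "p i \<notin> ?K" using ideal_block[OF assms(1)] by blast
  then show ?thesis using that p_closed[OF assms(1)] by blast
qed

lemma e_column: "i < r \<Longrightarrow> y \<in> carrier (column i) \<Longrightarrow> e i \<otimes> y = y"
proof -
  assume i: "i < r" and y: "y \<in> carrier (column i)"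
  then have yc: "y \<in> carrier A" "y \<otimes> p i = y" by auto
  have comm: "p i \<otimes> e i = p i" using centre_commutes[OF e_centre[OF i] p_closed[OF i]] p_block[OF i] by simp
  have "e i \<otimes> y = y \<otimes> p i \<otimes> e i" using yc centre_commutes[OF e_centre[OF i]] by simp
  also have "\<dots> = y \<otimes> p i" using m_assoc[OF yc(1) p_closed[OF i] e_closed[OF i]] comm by simp
  finally show ?thesis using yc by simp
qed

lemma irreducible_column: assumes "i < r" shows "irreducible_module A (column i)"
  unfolding irreducible_module_def
proof (intro conjI allI impI)
  note pc = p_closed[OF assms]
  show "left_module A (column i)" using left_module_column[OF assms] .
  show "carrier (column i) \<noteq> {\<zero>\<^bsub>column i\<^esub>}"
    using pc p_idem[OF assms] p_nonzero[OF assms] by auto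
  fix W assume W: "left_submodule A W (column i)"
  have "W = carrier (column i)" if "W \<noteq> {\<zero>}"
  proof -
    have "\<zero> \<in> W" using left_submoduleD(2)[OF W] by simp
    then have "\<not> W \<subseteq> {\<zero>}" using that by auto
    then obtain w where w: "w \<in> W" "w \<noteq> \<zero>" by auto
    then have wc: "w \<in> carrier A" "w \<otimes> p i = w" using left_submoduleD(1)[OF W] by auto
    have "e i \<otimes> w \<noteq> \<zero>" using e_column[OF assms, of w] w wc by simp
    then obtain x where x: "x \<in> carrier A" "p i \<otimes> x \<otimes> w \<noteq> \<zero>"
      using exists_product_nonzero[OF assms wc(1)] by blast
    \<comment> \<open>A nonzero multiple of \<open>w\<close> lies in the one-dimensional corner, hence so does \<open>p i\<close>.\<close>
    obtain c where c: "p i \<otimes> (x \<otimes> w) \<otimes> p i = c \<odot> p i" using corner[OF assms, of "x \<otimes> w"] x wc by auto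
    have cw: "p i \<otimes> x \<otimes> w = c \<odot> p i" using c wc x pc by (simp add: m_assoc)
    then have "c \<noteq> 0" using x(2) pc by auto
    have "(inverse c \<odot> (p i \<otimes> x)) \<otimes> w = p i" using cw wc x pc \<open>c \<noteq> 0\<close> by simp
    then have pW: "p i \<in> W" using left_submoduleD(4)[OF W, of "inverse c \<odot> (p i \<otimes> x)" w] w x pc by simp
    have "y \<in> W" if "y \<in> carrier (column i)" for y
      using left_submoduleD(4)[OF W, of y "p i"] pW that by auto
    then show ?thesis using left_submoduleD(1)[OF W] by blast
  qed
  then show "W = {\<zero>\<^bsub>column i\<^esub>} \<or> W = carrier (column i)" by auto
qed

definition acts_by :: "('a, 'v) module \<Rightarrow> nat \<Rightarrow> bool" where
  "acts_by M i \<longleftrightarrow> i < r \<and> (\<forall>v\<in>carrier M. e i \<odot>\<^bsub>M\<^esub> v = v)"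

text \<open>The sum of the \<open>e i\<close> is \<open>1\<close>, so some \<open>e i\<close> does not annihilate the module; since \<open>e i\<close> is
  central, the vectors that it fixes form a submodule.\<close>

lemma irreducible_acts_by:
  assumes M: "irreducible_module A M" obtains i where "acts_by M i"
proof -
  note lM = irreducibleD(1)[OF M]
  interpret M: abelian_group M using left_moduleD(2)[OF lM] .
  obtain v where v: "v \<in> carrier M" "v \<noteq> \<zero>\<^bsub>M\<^esub>" using irreducible_nonzero[OF M] .
  have "\<exists>i<r. e i \<odot>\<^bsub>M\<^esub> v \<noteq> \<zero>\<^bsub>M\<^esub>"
  proof (rule ccontr)
    assume "\<not> ?thesis"
    then have "(\<Oplus>i\<in>{..<r}. e i) \<in> {a \<in> carrier A. a \<odot>\<^bsub>M\<^esub> v = \<zero>\<^bsub>M\<^esub>}"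
      using v left_module_zero_smult[OF lM]
      by (intro finsum_mem) (auto simp: left_moduleD(4)[OF lM])
    then show False using e_sum v left_moduleD(7)[OF lM] by simp
  qed
  then obtain i where i: "i < r" "e i \<odot>\<^bsub>M\<^esub> v \<noteq> \<zero>\<^bsub>M\<^esub>" by blast
  let ?W = "{w \<in> carrier M. e i \<odot>\<^bsub>M\<^esub> w = w}"
  have "left_submodule A ?W M"
  proof (rule left_submoduleI[OF lM])
    fix a x assume a: "a \<in> carrier A" and x: "x \<in> ?W"
    have "e i \<odot>\<^bsub>M\<^esub> (a \<odot>\<^bsub>M\<^esub> x) = (e i \<otimes> a) \<odot>\<^bsub>M\<^esub> x" using a x i by (simp add: left_moduleD(6)[OF lM])
    also have "\<dots> = a \<odot>\<^bsub>M\<^esub> (e i \<odot>\<^bsub>M\<^esub> x)"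
      using a x i by (subst centre_commutes[OF e_centre]) (simp_all only: left_moduleD(6)[OF lM] e_closed mem_Collect_eq)
    finally show "a \<odot>\<^bsub>M\<^esub> x \<in> ?W" using a x left_moduleD(3)[OF lM] by simp
  qed (use i left_module_smult_zero[OF lM] in \<open>auto simp: left_moduleD(5)[OF lM]\<close>)
  moreover have "e i \<odot>\<^bsub>M\<^esub> v \<in> ?W"
    using i v left_moduleD(3)[OF lM] left_moduleD(6)[OF lM, of "e i" "e i" v] e_mult[of i i] by simp
  ultimately have "?W = carrier M" using irreducibleD(3)[OF M, of ?W] i by blast
  then show ?thesis using that i by (auto simp: acts_by_def)
qed

lemma acts_by_other:
  assumes "left_module A M" "acts_by M i" "j < r" "j \<noteq> i" "v \<in> carrier M"
  shows "e j \<odot>\<^bsub>M\<^esub> v = \<zero>\<^bsub>M\<^esub>"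
proof -
  have "e j \<odot>\<^bsub>M\<^esub> v = e j \<odot>\<^bsub>M\<^esub> (e i \<odot>\<^bsub>M\<^esub> v)" using assms by (simp add: acts_by_def)
  also have "\<dots> = (e j \<otimes> e i) \<odot>\<^bsub>M\<^esub> v" using assms by (simp add: left_moduleD(6)[OF assms(1)] acts_by_def)
  finally show ?thesis using assms e_mult[of j i] left_module_zero_smult by (auto simp: acts_by_def)
qed

text \<open>The annihilator of the module is a two-sided ideal that does not contain \<open>e i\<close>.\<close>

lemma exists_p_nonzero:
  assumes M: "irreducible_module A M" "acts_by M i"
  obtains v where "v \<in> carrier M" "p i \<odot>\<^bsub>M\<^esub> v \<noteq> \<zero>\<^bsub>M\<^esub>"
proof -
  note lM = irreducibleD(1)[OF M(1)]
  interpret M: abelian_group M using left_moduleD(2)[OF lM] .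
  have i: "i < r" using M(2) by (simp add: acts_by_def)
  let ?I = "{a \<in> carrier A. \<forall>v\<in>carrier M. a \<odot>\<^bsub>M\<^esub> v = \<zero>\<^bsub>M\<^esub>}"
  have "ideal ?I A"
  proof (rule idealI)
    have "\<ominus> a \<in> ?I" if "a \<in> ?I" for a
    proof -
      have "(\<ominus> \<one> \<otimes> a) \<odot>\<^bsub>M\<^esub> v = \<zero>\<^bsub>M\<^esub>" if "v \<in> carrier M" for v
        using \<open>a \<in> ?I\<close> that left_module_smult_zero[OF lM] by (subst left_moduleD(6)[OF lM]) auto
      then show ?thesis using that by (simp add: l_minus)
    qed
    then show "subgroup ?I (add_monoid A)"
      using left_module_zero_smult[OF lM]
      by (intro add.subgroupI) (auto simp: left_moduleD(4)[OF lM])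
  next
    fix a x assume ax: "a \<in> ?I" "x \<in> carrier A"
    then show "a \<otimes> x \<in> ?I" "x \<otimes> a \<in> ?I"
      using left_module_smult_zero[OF lM] by (auto simp: left_moduleD(3,6)[OF lM])
  qed (rule ring_axioms)
  moreover have "e i \<notin> ?I"
    using irreducible_nonzero[OF M(1)] M(2) unfolding acts_by_def by fastforce
  ultimately have "p i \<notin> ?I" using ideal_block[OF i] by blast
  then show ?thesis using that p_closed[OF i] by blast
qed

text \<open>Choose \<open>v\<close> with \<open>p i v \<noteq> 0\<close>.  Then \<open>y \<mapsto> y v\<close> is a nonzero homomorphism between irreducible modules.\<close>

lemma column_isomorphic:
  assumes M: "irreducible_module A M" "acts_by M i"
  shows "module_isomorphic A (column i) M"
proof -
  note lM = irreducibleD(1)[OF M(1)]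
  have i: "i < r" using M(2) by (simp add: acts_by_def)
  obtain v where v: "v \<in> carrier M" "p i \<odot>\<^bsub>M\<^esub> v \<noteq> \<zero>\<^bsub>M\<^esub>" using exists_p_nonzero[OF M] .
  let ?f = "\<lambda>y. y \<odot>\<^bsub>M\<^esub> v"
  have f: "?f \<in> LinearCombinations.module_hom A (column i) M"
    using v(1) by (intro module_homI) (auto simp: left_moduleD(3,4,6)[OF lM])
  have "p i \<in> carrier (column i)" using p_closed[OF i] p_idem[OF i] by simp
  then have "bij_betw ?f (carrier (column i)) (carrier M)"
    using irreducible_hom_bij[OF irreducible_column[OF i] M(1) f, of "p i"] v by blast
  then show ?thesis using f by (auto simp: module_isomorphic_def)
qed

lemma acts_by_isomorphic:
  assumes "irreducible_module A M" "acts_by M i" "irreducible_module A N" "acts_by N i"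
  shows "module_isomorphic A M N"
  using column_isomorphic[OF assms(1,2)] column_isomorphic[OF assms(3,4)] left_module_column[of i] assms(2)
  by (meson acts_by_def module_isomorphic_sym module_isomorphic_trans)

lemma isomorphic_acts_by:
  assumes "module_isomorphic A M N" "acts_by M i" shows "acts_by N i"
proof -
  obtain f where f: "f \<in> LinearCombinations.module_hom A M N" "bij_betw f (carrier M) (carrier N)"
    using assms by (auto simp: module_isomorphic_def)
  have "e i \<odot>\<^bsub>N\<^esub> f v = f v" if "v \<in> carrier M" for v
    using module_homD(3)[OF f(1), of "e i" v] that assms(2) by (simp add: acts_by_def)
  then have "e i \<odot>\<^bsub>N\<^esub> w = w" if "w \<in> carrier N" for w
    using f(2) that unfolding bij_betw_def by (metis imageE)
  then show ?thesis using assms(2) by (simp add: acts_by_def)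
qed

text \<open>An irreducible module is faithful on its block: if \<open>x e\<^sub>i \<noteq> 0\<close>, then the ideal generated by \<open>x\<close>
  contains a nonzero element of \<open>p\<^sub>i A p\<^sub>i\<close>, hence \<open>p\<^sub>i\<close>, which does not annihilate the module.\<close>

lemma acts_by_annihilator:
  assumes M: "irreducible_module A M" "acts_by M i" and x: "x \<in> carrier A"
    and zero: "\<And>v. v \<in> carrier M \<Longrightarrow> x \<odot>\<^bsub>M\<^esub> v = \<zero>\<^bsub>M\<^esub>"
  shows "x \<otimes> e i = \<zero>"
proof (rule ccontr)
  assume "x \<otimes> e i \<noteq> \<zero>"
  note lM = irreducibleD(1)[OF M(1)]
  have i: "i < r" using M(2) by (simp add: acts_by_def)
  note pc = p_closed[OF i]
  have "e i \<otimes> x \<noteq> \<zero>" using \<open>x \<otimes> e i \<noteq> \<zero>\<close> centre_commutes[OF e_centre[OF i] x] by simp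
  then obtain a where a: "a \<in> carrier A" "p i \<otimes> a \<otimes> x \<noteq> \<zero>"
    using exists_product_nonzero[OF i x] by blast
  \<comment> \<open>The elements \<open>y\<close> with \<open>p i \<otimes> a \<otimes> x \<otimes> b \<otimes> y = 0\<close> for all \<open>b\<close> form a two-sided ideal.\<close>
  let ?w = "p i \<otimes> a \<otimes> x"
  let ?K = "{y \<in> carrier A. \<forall>b\<in>carrier A. ?w \<otimes> b \<otimes> y = \<zero>}"
  have wc: "?w \<in> carrier A" using pc a x by simp
  have "ideal ?K A"
  proof (rule idealI)
    show "subgroup ?K (add_monoid A)"
      using wc by (intro add.subgroupI) (auto simp: r_distr r_minus simp flip: a_inv_def)
    fix y z assume y: "y \<in> ?K" and z: "z \<in> carrier A"
    have "?w \<otimes> b \<otimes> (y \<otimes> z) = \<zero>" "?w \<otimes> b \<otimes> (z \<otimes> y) = \<zero>" if "b \<in> carrier A" for b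
    proof -
      have "?w \<otimes> b \<otimes> (y \<otimes> z) = ?w \<otimes> b \<otimes> y \<otimes> z"
        using m_assoc[of "?w \<otimes> b" y z, symmetric] wc y z that by simp
      then show "?w \<otimes> b \<otimes> (y \<otimes> z) = \<zero>" using y z that by auto
      have "?w \<otimes> b \<otimes> (z \<otimes> y) = ?w \<otimes> (b \<otimes> z) \<otimes> y"
        using m_assoc[of "?w \<otimes> b" z y] m_assoc[of ?w b z] wc y z that by auto
      then show "?w \<otimes> b \<otimes> (z \<otimes> y) = \<zero>" using y z that by auto
    qed
    then show "y \<otimes> z \<in> ?K" "z \<otimes> y \<in> ?K" using y z by auto
  qed (rule ring_axioms)
  moreover have "e i \<notin> ?K"
  proof -
    have "?w \<otimes> \<one> \<otimes> e i = e i \<otimes> p i \<otimes> a \<otimes> x"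
      using wc i pc a x by (simp add: centre_commutes[OF e_centre[OF i], symmetric] m_assoc[symmetric])
    then show ?thesis using a p_block[OF i] by (auto intro!: bexI[of _ \<one>])
  qed
  ultimately have "p i \<notin> ?K" using ideal_block[OF i] by blast
  then obtain b where b: "b \<in> carrier A" "?w \<otimes> b \<otimes> p i \<noteq> \<zero>" using pc by blast
  obtain c where c: "p i \<otimes> (a \<otimes> x \<otimes> b) \<otimes> p i = c \<odot> p i" using corner[OF i, of "a \<otimes> x \<otimes> b"] a x b by auto
  then have cw: "?w \<otimes> b \<otimes> p i = c \<odot> p i" using pc a x b by (simp add: m_assoc)
  then have "c \<noteq> 0" using b pc by auto
  obtain v where v: "v \<in> carrier M" "p i \<odot>\<^bsub>M\<^esub> v \<noteq> \<zero>\<^bsub>M\<^esub>" using exists_p_nonzero[OF M] .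
  have "p i = inverse c \<odot> (c \<odot> p i)" using pc \<open>c \<noteq> 0\<close> by simp
  also have "\<dots> = (inverse c \<odot> (p i \<otimes> a)) \<otimes> (x \<otimes> (b \<otimes> p i))"
    using pc a x b by (simp add: m_assoc flip: cw)
  finally have "p i \<odot>\<^bsub>M\<^esub> v = ((inverse c \<odot> (p i \<otimes> a)) \<otimes> (x \<otimes> (b \<otimes> p i))) \<odot>\<^bsub>M\<^esub> v" by simp
  also have "\<dots> = (inverse c \<odot> (p i \<otimes> a)) \<odot>\<^bsub>M\<^esub> (x \<odot>\<^bsub>M\<^esub> ((b \<otimes> p i) \<odot>\<^bsub>M\<^esub> v))"
    using pc a x b v by (subst left_moduleD(6)[OF lM] | (simp; fail))+
  also have "\<dots> = \<zero>\<^bsub>M\<^esub>"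
    using pc a x b v zero left_moduleD(3)[OF lM] left_module_smult_zero[OF lM] by simp
  finally show False using v by simp
qed

lemma scaled_idempotent:
  assumes "x \<in> carrier A" "x \<noteq> \<zero>" "x \<otimes> x = x" "(c \<odot> x) \<otimes> (c \<odot> x) = c \<odot> x"
  shows "c = 0 \<or> c = 1"
proof -
  have "(c * c) \<odot> x = c \<odot> x" using assms by simp
  then show ?thesis using scale_inject[OF assms(1,2)] by fastforce
qed

lemma primitive_e: assumes "i < r" shows "primitive_central_idempotent A (e i)"
  unfolding primitive_central_idempotent_def
proof (intro conjI ballI impI)
  fix f g
  assume f: "f \<in> centre A" and g: "g \<in> centre A"
    and fg: "f \<otimes> f = f \<and> g \<otimes> g = g \<and> f \<otimes> g = \<zero> \<and> e i = f \<oplus> g"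
  obtain c where c: "f \<otimes> e i = c \<odot> e i" using centre_block[OF f assms] by blast
  have fc: "f = c \<odot> e i" using fg f g c by (simp add: r_distr)
  then have "(c \<odot> e i) \<otimes> (c \<odot> e i) = c \<odot> e i" using fg by metis
  then have "c = 0 \<or> c = 1"
    using scaled_idempotent[of "e i" c] assms e_mult[of i i] e_nonzero by simp
  then show "f = \<zero> \<or> g = \<zero>"
  proof
    assume "c = 1"
    then have "e i = f" using fc assms by simp
    then have "f \<oplus> g = f" using fg by simp
    then show ?thesis using f g add.l_cancel_one[of f g] by simp
  qed (use fc assms in simp)
qed (use assms e_centre e_mult e_nonzero in auto)

text \<open>Write \<open>h = h e\<^sub>i + (h - h e\<^sub>i)\<close>, a sum of orthogonal central idempotents.  As \<open>h\<close> is primitive and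
  \<open>h e\<^sub>i \<noteq> 0\<close>, the second summand is zero, so \<open>h\<close> is an idempotent multiple of \<open>e\<^sub>i\<close>.\<close>

lemma primitive_unique:
  assumes h: "primitive_central_idempotent A h" and i: "i < r" and "h \<otimes> e i \<noteq> \<zero>"
  shows "h = e i"
proof -
  have hc: "h \<in> centre A" "h \<otimes> h = h" using h by (auto simp: primitive_central_idempotent_def)
  obtain c where c: "h \<otimes> e i = c \<odot> e i" using centre_block[OF hc(1) i] by blast
  have comm: "h \<otimes> e i = e i \<otimes> h" using centre_commutes[OF hc(1)] i by simp
  let ?f = "h \<otimes> e i" and ?g = "h \<ominus> h \<otimes> e i"
  have ff: "?f \<otimes> ?f = ?f"
  proof -
    have "?f \<otimes> ?f = h \<otimes> (e i \<otimes> h) \<otimes> e i" using hc(1) i by (simp add: m_assoc)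
    also have "\<dots> = (h \<otimes> h) \<otimes> (e i \<otimes> e i)" using hc(1) i unfolding comm[symmetric] by (simp add: m_assoc)
    finally show ?thesis using hc i e_mult[of i i] by simp
  qed
  have hf: "h \<otimes> ?f = ?f" using hc i by (simp flip: m_assoc)
  have fh: "?f \<otimes> h = ?f" using hf hc(1) i by (simp add: centre_commutes[OF hc(1)])
  have fcl: "?f \<in> carrier A" "?g \<in> carrier A" using hc(1) i by auto
  have fcen: "?f \<in> centre A" unfolding centre_def
  proof (intro CollectI conjI ballI)
    fix x assume "x \<in> carrier A"
    then show "?f \<otimes> x = x \<otimes> ?f" using i centre_commutes[OF e_centre[OF i], of x] by (simp add: c)
  qed (use fcl in auto)
  have gcen: "?g \<in> centre A" unfolding centre_def
  proof (intro CollectI conjI ballI)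
    fix x assume "x \<in> carrier A"
    then show "?g \<otimes> x = x \<otimes> ?g"
      using centre_commutes[OF fcen, of x] centre_commutes[OF hc(1), of x] hc(1) fcl(1)
      by (simp add: minus_eq l_distr r_distr l_minus r_minus)
  qed (use fcl in auto)
  have gg: "?g \<otimes> ?g = ?g" and fg: "?f \<otimes> ?g = \<zero>" and sum: "h = ?f \<oplus> ?g"
    using hc fcl(1) ff hf fh
    by (simp_all add: minus_eq l_distr r_distr l_minus r_minus a_assoc r_neg l_neg minus_minus)
       (simp_all add: a_comm[of "?f"] r_neg a_assoc l_neg minus_add)
  have "?g = \<zero>"
    using h fcen gcen ff gg fg sum assms(3) unfolding primitive_central_idempotent_def by blast
  then have hf': "h = c \<odot> e i" using sum c i hc(1) by simp
  then have "c = 0 \<or> c = 1"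
    using scaled_idempotent[of "e i" c] hc(2) i e_mult[of i i] e_nonzero by simp
  then show ?thesis using hf' assms(3) i by auto
qed

end

lemma Irr_iff:
  fixes A :: "('k, 'a) module" shows
  "\<nu> \<in> Irr A \<longleftrightarrow>
    (\<exists>M :: ('a, 'a) module. irreducible_module A M \<and> \<nu> = {N. irreducible_module A N \<and> module_isomorphic A M N})"
proof -
  let ?E = "{(M :: ('a, 'a) module, N :: ('a, 'a) module). irreducible_module A M \<and> irreducible_module A N \<and> module_isomorphic A M N}"
  have *: "?E `` {M} = {N. irreducible_module A N \<and> module_isomorphic A M N}"
    if "irreducible_module A M" for M :: "('a, 'a) module"
    using that by auto
  have "\<nu> \<in> Irr A \<longleftrightarrow> (\<exists>M :: ('a, 'a) module. irreducible_module A M \<and> \<nu> = ?E `` {M})"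
    unfolding Irr_def quotient_def by blast
  also have "\<dots> \<longleftrightarrow> (\<exists>M :: ('a, 'a) module. irreducible_module A M \<and>
      \<nu> = {N. irreducible_module A N \<and> module_isomorphic A M N})"
    by (rule ex_cong1) (simp only: * cong: conj_cong)
  finally show ?thesis .
qed

lemma irr_class:
  fixes A :: "('k, 'a) module" and M :: "('a, 'a) module"
  shows "irreducible_module A M \<Longrightarrow> {N. irreducible_module A N \<and> module_isomorphic A M N} \<in> Irr A"
  by (subst Irr_iff) (rule exI, rule conjI[OF _ refl])

lemma irr_rep_mem:
  fixes A :: "('k, 'a) module"
  assumes "\<nu> \<in> Irr A" shows "irr_rep \<nu> \<in> \<nu>"
proof -
  obtain M :: "('a, 'a) module" where "irreducible_module A M" "\<nu> = {N. irreducible_module A N \<and> module_isomorphic A M N}"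
    using assms unfolding Irr_iff by blast
  then have "M \<in> \<nu>" using module_isomorphic_refl by auto
  then show ?thesis unfolding irr_rep_def by (rule someI)
qed

lemma irreducible_irr_rep:
  fixes A :: "('k, 'a) module"
  assumes "\<nu> \<in> Irr A" shows "irreducible_module A (irr_rep \<nu>)"
  using irr_rep_mem[OF assms] assms unfolding Irr_iff by blast

lemma Irr_eqI:
  fixes A :: "('k, 'a) module"
  assumes "\<nu> \<in> Irr A" "\<nu>' \<in> Irr A" "module_isomorphic A (irr_rep \<nu>) (irr_rep \<nu>')"
  shows "\<nu> = \<nu>'"
proof -
  have eq: "\<kappa> = {N. irreducible_module A N \<and> module_isomorphic A (irr_rep \<kappa>) N}" if k: "\<kappa> \<in> Irr A" for \<kappa>
  proof -
    obtain M :: "('a, 'a) module" where M: "irreducible_module A M" "\<kappa> = {N. irreducible_module A N \<and> module_isomorphic A M N}"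
      using k unfolding Irr_iff by blast
    have "module_isomorphic A M (irr_rep \<kappa>)" using irr_rep_mem[OF k] M by auto
    then show ?thesis
      unfolding M(2) using module_isomorphic_trans module_isomorphic_sym irreducibleD(1)[OF M(1)]
      by (metis (no_types, lifting) M(2))
  qed
  have "module_isomorphic A (irr_rep \<nu>') (irr_rep \<nu>)"
    using module_isomorphic_sym assms irreducibleD(1)[OF irreducible_irr_rep] by blast
  then show ?thesis using eq[OF assms(1)] eq[OF assms(2)] assms(3) module_isomorphic_trans by blast
qed

context block_algebra
begin

text \<open>This settles the definite description in \<^const>\<open>eps\<close>.  Existence: representatives of different
  classes belong to different blocks, because a block has only one irreducible module up to
  isomorphism.  Uniqueness: a competitor does not annihilate \<open>e i\<close>, since both act as the identity on
  the representative.\<close>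

lemma eps_eq_e:
  assumes \<nu>: "\<nu> \<in> Irr A" and i: "acts_by (irr_rep \<nu>) i"
  shows "eps A \<nu> = e i"
  unfolding eps_def
proof (rule the_equality)
  have ir: "i < r" using i by (simp add: acts_by_def)
  have "e i \<odot>\<^bsub>irr_rep \<nu>'\<^esub> v = \<zero>\<^bsub>irr_rep \<nu>'\<^esub>"
    if \<nu>': "\<nu>' \<in> Irr A" "\<nu>' \<noteq> \<nu>" "v \<in> carrier (irr_rep \<nu>')" for \<nu>' v
  proof -
    note irr = irreducible_irr_rep[OF \<nu>'(1)]
    obtain j where j: "acts_by (irr_rep \<nu>') j" using irreducible_acts_by[OF irr] .
    have "j \<noteq> i"
      using acts_by_isomorphic[OF irr j irreducible_irr_rep[OF \<nu>], of] i Irr_eqI[OF \<nu>'(1) \<nu>] \<nu>'(2) by auto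
    then show ?thesis using acts_by_other[OF irreducibleD(1)[OF irr] j ir] \<nu>'(3) by auto
  qed
  then show "primitive_central_idempotent A (e i) \<and>
     (\<forall>v\<in>carrier (irr_rep \<nu>). e i \<odot>\<^bsub>irr_rep \<nu>\<^esub> v = v) \<and>
     (\<forall>\<nu>'\<in>Irr A. \<nu>' \<noteq> \<nu> \<longrightarrow>
        (\<forall>v\<in>carrier (irr_rep \<nu>'). e i \<odot>\<^bsub>irr_rep \<nu>'\<^esub> v = \<zero>\<^bsub>irr_rep \<nu>'\<^esub>))"
    using primitive_e[OF ir] i by (simp add: acts_by_def)
next
  fix h
  assume h: "primitive_central_idempotent A h \<and>
     (\<forall>v\<in>carrier (irr_rep \<nu>). h \<odot>\<^bsub>irr_rep \<nu>\<^esub> v = v) \<and>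
     (\<forall>\<nu>'\<in>Irr A. \<nu>' \<noteq> \<nu> \<longrightarrow>
        (\<forall>v\<in>carrier (irr_rep \<nu>'). h \<odot>\<^bsub>irr_rep \<nu>'\<^esub> v = \<zero>\<^bsub>irr_rep \<nu>'\<^esub>))"
  have ir: "i < r" using i by (simp add: acts_by_def)
  note irr = irreducible_irr_rep[OF \<nu>]
  obtain v where v: "v \<in> carrier (irr_rep \<nu>)" "v \<noteq> \<zero>\<^bsub>irr_rep \<nu>\<^esub>" using irreducible_nonzero[OF irr] .
  have hc: "h \<in> carrier A" using h by (simp add: primitive_central_idempotent_def)
  have "(h \<otimes> e i) \<odot>\<^bsub>irr_rep \<nu>\<^esub> v = v"
    using v h i hc ir by (simp add: left_moduleD(6)[OF irreducibleD(1)[OF irr]] acts_by_def)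
  then have "h \<otimes> e i \<noteq> \<zero>"
    using v left_module_zero_smult[OF irreducibleD(1)[OF irr]] by auto
  then show "h = e i" using primitive_unique h ir by blast
qed

lemma eps_block:
  assumes "\<nu> \<in> Irr A" obtains i where "acts_by (irr_rep \<nu>) i" "i < r" "eps A \<nu> = e i"
  using irreducible_acts_by[OF irreducible_irr_rep[OF assms]] eps_eq_e[OF assms]
  by (metis acts_by_def)

text \<open>The left ideal of the block represents an isomorphism class with this idempotent.\<close>

lemma block_eps:
  assumes "i < r" obtains \<nu> where "\<nu> \<in> Irr A" "eps A \<nu> = e i"
proof -
  let ?\<nu> = "{N. irreducible_module A N \<and> module_isomorphic A (column i) N}"
  have \<nu>: "?\<nu> \<in> Irr A" using irr_class[OF irreducible_column[OF assms]] .
  have "module_isomorphic A (column i) (irr_rep ?\<nu>)" using irr_rep_mem[OF \<nu>] by auto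
  moreover have "acts_by (column i) i" using assms e_column[OF assms] by (auto simp: acts_by_def)
  ultimately have "acts_by (irr_rep ?\<nu>) i"
    using isomorphic_acts_by by blast
  then show ?thesis using that \<nu> eps_eq_e by blast
qed

end

text \<open>From here on the choice of \<open>e\<close> and \<open>p\<close> is hidden: the facts speak of \<^const>\<open>Irr\<close> and \<^const>\<open>eps\<close>
  only.\<close>

locale split_semisimple_algebra =
  fixes A :: "('k::field, 'a) module" (structure)
  assumes split: "split_semisimple A"

sublocale split_semisimple_algebra \<subseteq> algebra_over A
  using split by (auto intro: algebra_overI simp: split_semisimple_def)

context split_semisimple_algebra
begin

lemma eps_centre: assumes "\<nu> \<in> Irr A" shows "eps A \<nu> \<in> centre A"
proof -
  obtain r e p where "block_algebra A r e p" using split_semisimple_blocks[OF split] .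
  then interpret block_algebra A r e p .
  show ?thesis using eps_block[OF assms] e_centre by metis
qed

lemma eps_closed [simp, intro]: "\<nu> \<in> Irr A \<Longrightarrow> eps A \<nu> \<in> carrier A"
  using eps_centre by simp

lemma eps_nonzero: assumes "\<nu> \<in> Irr A" shows "eps A \<nu> \<noteq> \<zero>"
proof -
  obtain r e p where "block_algebra A r e p" using split_semisimple_blocks[OF split] .
  then interpret block_algebra A r e p .
  show ?thesis using eps_block[OF assms] e_nonzero by metis
qed

lemma eps_mult:
  assumes "\<nu> \<in> Irr A" "\<nu>' \<in> Irr A"
  shows "eps A \<nu> \<otimes> eps A \<nu>' = (if \<nu> = \<nu>' then eps A \<nu> else \<zero>)"
proof -
  obtain r e p where "block_algebra A r e p" using split_semisimple_blocks[OF split] .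
  then interpret block_algebra A r e p .
  obtain i where i: "acts_by (irr_rep \<nu>) i" "i < r" "eps A \<nu> = e i" using eps_block[OF assms(1)] .
  obtain j where j: "acts_by (irr_rep \<nu>') j" "j < r" "eps A \<nu>' = e j" using eps_block[OF assms(2)] .
  have "\<nu> = \<nu>'" if "i = j"
    using acts_by_isomorphic[OF irreducible_irr_rep[OF assms(1)] i(1) irreducible_irr_rep[OF assms(2)]]
      j that Irr_eqI[OF assms] by simp
  then show ?thesis using i j e_mult[of i j] e_mult[of i i] e_nonzero[of i] by auto
qed

lemma finite_Irr: "finite (Irr A)"
proof -
  obtain r e p where "block_algebra A r e p" using split_semisimple_blocks[OF split] .
  then interpret block_algebra A r e p .
  have "eps A ` Irr A \<subseteq> e ` {..<r}" using eps_block by blast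
  moreover have "inj_on (eps A) (Irr A)"
    by (rule inj_onI) (metis eps_mult eps_nonzero)
  ultimately show ?thesis using finite_imageD finite_subset by blast
qed

lemma eps_detect:
  assumes "x \<in> carrier A" "\<And>\<nu>. \<nu> \<in> Irr A \<Longrightarrow> x \<otimes> eps A \<nu> = \<zero>" shows "x = \<zero>"
proof -
  obtain r e p where "block_algebra A r e p" using split_semisimple_blocks[OF split] .
  then interpret block_algebra A r e p .
  show ?thesis
  proof (rule detect_zero[OF assms(1)])
    fix i assume i: "i < r"
    obtain \<nu> where "\<nu> \<in> Irr A" "eps A \<nu> = e i" using block_eps[OF i] .
    then show "e i \<otimes> x = \<zero>" using assms centre_commutes[OF e_centre[OF i]] by metis
  qed
qed

lemma centre_eps:
  assumes "z \<in> centre A" "\<nu> \<in> Irr A" shows "\<exists>c. z \<otimes> eps A \<nu> = c \<odot> eps A \<nu>"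
proof -
  obtain r e p where "block_algebra A r e p" using split_semisimple_blocks[OF split] .
  then interpret block_algebra A r e p .
  show ?thesis using eps_block[OF assms(2)] centre_block[OF assms(1)] by metis
qed

lemma eps_acts_one:
  assumes "\<nu> \<in> Irr A" "v \<in> carrier (irr_rep \<nu>)" shows "eps A \<nu> \<odot>\<^bsub>irr_rep \<nu>\<^esub> v = v"
proof -
  obtain r e p where "block_algebra A r e p" using split_semisimple_blocks[OF split] .
  then interpret block_algebra A r e p .
  show ?thesis using eps_block[OF assms(1)] assms(2) by (metis acts_by_def)
qed

lemma eps_acts_nonzero:
  assumes "\<nu> \<in> Irr A" "irreducible_module A M" "v \<in> carrier M" "eps A \<nu> \<odot>\<^bsub>M\<^esub> v \<noteq> \<zero>\<^bsub>M\<^esub>"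
  shows "module_isomorphic A (irr_rep \<nu>) M"
proof -
  obtain r e p where "block_algebra A r e p" using split_semisimple_blocks[OF split] .
  then interpret block_algebra A r e p .
  obtain i where i: "acts_by (irr_rep \<nu>) i" "i < r" "eps A \<nu> = e i" using eps_block[OF assms(1)] .
  obtain j where j: "acts_by M j" using irreducible_acts_by[OF assms(2)] .
  have "i = j" using acts_by_other[OF irreducibleD(1)[OF assms(2)] j i(2)] i(3) assms(3,4) by auto
  then show ?thesis using acts_by_isomorphic[OF irreducible_irr_rep[OF assms(1)] i(1) assms(2)] j by simp
qed

lemma annihilator_eps:
  assumes "\<nu> \<in> Irr A" "x \<in> carrier A" "\<And>v. v \<in> carrier (irr_rep \<nu>) \<Longrightarrow> x \<odot>\<^bsub>irr_rep \<nu>\<^esub> v = \<zero>\<^bsub>irr_rep \<nu>\<^esub>"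
  shows "x \<otimes> eps A \<nu> = \<zero>"
proof -
  obtain r e p where "block_algebra A r e p" using split_semisimple_blocks[OF split] .
  then interpret block_algebra A r e p .
  obtain i where i: "acts_by (irr_rep \<nu>) i" "i < r" "eps A \<nu> = e i" using eps_block[OF assms(1)] .
  show ?thesis using acts_by_annihilator[OF irreducible_irr_rep[OF assms(1)] i(1) assms(2,3)] i(3) by simp
qed

end

section \<open>Restriction and direct summands\<close>

lemma restrict_scalars_simps [simp]:
  "carrier (restrict_scalars \<phi> M) = carrier M" "add (restrict_scalars \<phi> M) = add M"
  "zero (restrict_scalars \<phi> M) = zero M" "smult (restrict_scalars \<phi> M) a v = \<phi> a \<odot>\<^bsub>M\<^esub> v"
  by (simp_all add: restrict_scalars_def)

lemma left_module_restrict_scalars: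
  assumes "ring A" "\<phi> \<in> algebra_hom A B" "left_module B M"
  shows "left_module A (restrict_scalars \<phi> M)"
proof -
  interpret M: abelian_group M using left_moduleD(2)[OF assms(3)] .
  have "abelian_group (restrict_scalars \<phi> M)"
    by (rule abelian_groupI) (auto simp: M.a_assoc M.a_comm M.a_lcomm intro: M.l_neg M.a_inv_closed)
  then show ?thesis
    by (intro left_module.intro left_module_axioms.intro assms(1))
      (simp_all add: algebra_homD[OF assms(2)] left_moduleD[OF assms(3)])
qed

text \<open>Pull back along the isomorphism the vectors supported on component \<open>i\<close>, and as a complement those
  whose component \<open>i\<close> vanishes.\<close>

lemma family_sum_summand:
  assumes M: "left_module A M" and W: "\<And>j. j \<in> I \<Longrightarrow> left_module A (W j)"
    and iso: "module_isomorphic A M (family_sum I W)" and i: "i \<in> I"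
    and N: "module_isomorphic A N (W i)"
  shows "isomorphic_to_summand A N M"
proof -
  interpret M: abelian_group M using left_moduleD(2)[OF M] .
  have Wg: "abelian_group (W j)" if "j \<in> I" for j using left_moduleD(2)[OF W[OF that]] .
  have W0: "\<zero>\<^bsub>W j\<^esub> \<in> carrier (W j)" "\<zero>\<^bsub>W j\<^esub> \<oplus>\<^bsub>W j\<^esub> \<zero>\<^bsub>W j\<^esub> = \<zero>\<^bsub>W j\<^esub>" if "j \<in> I" for j
  proof -
    interpret Wj: abelian_group "W j" using Wg[OF that] .
    show "\<zero>\<^bsub>W j\<^esub> \<in> carrier (W j)" "\<zero>\<^bsub>W j\<^esub> \<oplus>\<^bsub>W j\<^esub> \<zero>\<^bsub>W j\<^esub> = \<zero>\<^bsub>W j\<^esub>" by simp_all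
  qed
  obtain h where h: "h \<in> LinearCombinations.module_hom A M (family_sum I W)"
    and bij: "bij_betw h (carrier M) (carrier (family_sum I W))"
    using iso by (auto simp: module_isomorphic_def)
  have F: "carrier (family_sum I W) = (\<Pi>\<^sub>E j\<in>I. carrier (W j))" by (simp add: family_sum_def)
  have hc: "h v j \<in> carrier (W j)" if "v \<in> carrier M" "j \<in> I" for v j
    using module_homD(1)[OF h that(1)] that(2) by (auto simp: F PiE_iff)
  have hadd: "h (v \<oplus>\<^bsub>M\<^esub> w) j = h v j \<oplus>\<^bsub>W j\<^esub> h w j" if "v \<in> carrier M" "w \<in> carrier M" "j \<in> I" for v w j
    using module_homD(2)[OF h that(1,2)] that(3) by (simp add: family_sum_def)
  have hsm: "h (a \<odot>\<^bsub>M\<^esub> v) j = a \<odot>\<^bsub>W j\<^esub> h v j" if "a \<in> carrier A" "v \<in> carrier M" "j \<in> I" for a v j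
    using module_homD(3)[OF h that(1,2)] that(3) by (simp add: family_sum_def)
  have hext: "v = w" if "v \<in> carrier M" "w \<in> carrier M" "\<And>j. j \<in> I \<Longrightarrow> h v j = h w j" for v w
  proof -
    have "h v = h w"
      using module_homD(1)[OF h that(1)] module_homD(1)[OF h that(2)] that(3)
      unfolding F by (intro PiE_ext) auto
    then show ?thesis using bij that(1,2) by (auto simp: bij_betw_def inj_on_def)
  qed
  have h0: "h \<zero>\<^bsub>M\<^esub> j = \<zero>\<^bsub>W j\<^esub>" if "j \<in> I" for j
    by (rule additive_zero[OF M.abelian_group_axioms Wg[OF that]]) (auto simp: hc hadd that)
  \<comment> \<open>\<open>g\<close> embeds the component \<open>i\<close>.\<close>
  let ?F = "\<lambda>w. \<lambda>j\<in>I. if j = i then w else \<zero>\<^bsub>W j\<^esub>"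
  define g where "g w = inv_into (carrier M) h (?F w)" for w
  have g: "g w \<in> carrier M" "\<And>j. j \<in> I \<Longrightarrow> h (g w) j = (if j = i then w else \<zero>\<^bsub>W j\<^esub>)"
    if "w \<in> carrier (W i)" for w
  proof -
    have "?F w \<in> carrier (family_sum I W)" using that W0 by (auto simp: F)
    then have "?F w \<in> h ` carrier M" using bij by (auto simp: bij_betw_def)
    then show "g w \<in> carrier M" "\<And>j. j \<in> I \<Longrightarrow> h (g w) j = (if j = i then w else \<zero>\<^bsub>W j\<^esub>)"
      by (simp_all add: g_def f_inv_into_f inv_into_into)
  qed
  interpret Wi: abelian_group "W i" using Wg[OF i] .
  let ?U = "{v \<in> carrier M. \<forall>j\<in>I. j \<noteq> i \<longrightarrow> h v j = \<zero>\<^bsub>W j\<^esub>}"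
  let ?U' = "{v \<in> carrier M. h v i = \<zero>\<^bsub>W i\<^esub>}"
  have "left_submodule A ?U M"
    by (rule left_submoduleI[OF M])
      (auto simp: h0 hadd hsm W0 left_moduleD(3)[OF M] left_module_smult_zero[OF W])
  moreover have "left_submodule A ?U' M"
    using i by (intro left_submoduleI[OF M])
      (auto simp: h0 hadd hsm left_moduleD(3)[OF M] left_module_smult_zero[OF W])
  moreover have "?U \<inter> ?U' = {\<zero>\<^bsub>M\<^esub>}"
  proof -
    have "v = \<zero>\<^bsub>M\<^esub>" if "v \<in> ?U" "v \<in> ?U'" for v
    proof (rule hext)
      fix j assume "j \<in> I"
      then show "h v j = h \<zero>\<^bsub>M\<^esub> j" using that h0 by (cases "j = i") auto
    qed (use that in auto)
    then show ?thesis using h0 i by auto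
  qed
  moreover have "?U <+>\<^bsub>M\<^esub> ?U' = carrier M"
  proof
    show "carrier M \<subseteq> ?U <+>\<^bsub>M\<^esub> ?U'"
    proof
      fix v assume v: "v \<in> carrier M"
      let ?u = "g (h v i)"
      have u: "?u \<in> carrier M" using g(1) hc v i by blast
      have "h (?u \<oplus>\<^bsub>M\<^esub> (v \<ominus>\<^bsub>M\<^esub> ?u)) i = h v i \<oplus>\<^bsub>W i\<^esub> h (v \<ominus>\<^bsub>M\<^esub> ?u) i"
        using u v i g(2)[of "h v i" i] hc[of v i] by (subst hadd) auto
      moreover have "?u \<oplus>\<^bsub>M\<^esub> (v \<ominus>\<^bsub>M\<^esub> ?u) = v"
        using u v by (simp add: M.minus_eq M.a_comm M.a_lcomm M.r_neg)
      ultimately have "h (v \<ominus>\<^bsub>M\<^esub> ?u) i = \<zero>\<^bsub>W i\<^esub>"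
        using hc[of v i] hc[of "v \<ominus>\<^bsub>M\<^esub> ?u" i] u v i Wi.add.l_cancel_one[of "h v i"] by simp
      then have "v \<ominus>\<^bsub>M\<^esub> ?u \<in> ?U'" using u v by simp
      moreover have "?u \<in> ?U" using u g(2)[of "h v i"] hc[of v i] v i by simp
      ultimately show "v \<in> ?U <+>\<^bsub>M\<^esub> ?U'"
        using \<open>?u \<oplus>\<^bsub>M\<^esub> (v \<ominus>\<^bsub>M\<^esub> ?u) = v\<close>[symmetric] unfolding set_add_def' by blast
    qed
  qed (auto simp: set_add_def')
  moreover have "module_isomorphic A N (M\<lparr>carrier := ?U\<rparr>)"
  proof -
    have "g \<in> LinearCombinations.module_hom A (W i) (M\<lparr>carrier := ?U\<rparr>)"
    proof (rule module_homI)
      fix x assume x: "x \<in> carrier (W i)"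
      then show "g x \<in> carrier (M\<lparr>carrier := ?U\<rparr>)" using g by simp
      fix y assume y: "y \<in> carrier (W i)"
      have "g (x \<oplus>\<^bsub>W i\<^esub> y) = g x \<oplus>\<^bsub>M\<^esub> g y"
        using x y by (intro hext) (auto simp: g hadd W0)
      then show "g (x \<oplus>\<^bsub>W i\<^esub> y) = g x \<oplus>\<^bsub>M\<lparr>carrier := ?U\<rparr>\<^esub> g y" by simp
    next
      fix a x assume a: "a \<in> carrier A" and x: "x \<in> carrier (W i)"
      have "a \<odot>\<^bsub>W i\<^esub> x \<in> carrier (W i)" using left_moduleD(3)[OF W[OF i] a x] .
      then have "g (a \<odot>\<^bsub>W i\<^esub> x) = a \<odot>\<^bsub>M\<^esub> g x"
        using a x left_moduleD(3)[OF M a]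
        by (intro hext) (auto simp: g hsm left_module_smult_zero[OF W])
      then show "g (a \<odot>\<^bsub>W i\<^esub> x) = a \<odot>\<^bsub>M\<lparr>carrier := ?U\<rparr>\<^esub> g x" by simp
    qed
    moreover have "bij_betw g (carrier (W i)) ?U"
    proof (rule bij_betw_byWitness[where f' = "\<lambda>v. h v i"])
      show "\<forall>v\<in>?U. g (h v i) = v"
        using hc i by (auto intro!: hext simp: g)
    qed (use g hc i in auto)
    ultimately have "module_isomorphic A (W i) (M\<lparr>carrier := ?U\<rparr>)"
      by (auto simp: module_isomorphic_def)
    then show ?thesis using module_isomorphic_trans[OF N] by blast
  qed
  ultimately show ?thesis unfolding isomorphic_to_summand_def by blast
qed

section \<open>Path idempotents\<close>

context algebra_over
begin

text \<open>A property that holds for generators and defines a subalgebra holds on everything they generate.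
  With \<open>F\<close> a single path idempotent this shows that the Gelfand-Zetlin algebra acts on it by scalars;
  with \<open>F\<close> a pair of path idempotents it compares the two scalars.\<close>

lemma unital_subalgebra_eigen:
  assumes F: "F \<subseteq> carrier A"
  shows "unital_subalgebra {x \<in> carrier A. \<exists>c. \<forall>f\<in>F. x \<otimes> f = c \<odot> f} A"
proof (rule unital_subalgebraI)
  show "\<one> \<in> {x \<in> carrier A. \<exists>c. \<forall>f\<in>F. x \<otimes> f = c \<odot> f}"
    using F by (auto intro!: exI[of _ 1])
next
  fix x y assume x: "x \<in> {x \<in> carrier A. \<exists>c. \<forall>f\<in>F. x \<otimes> f = c \<odot> f}"
    and y: "y \<in> {x \<in> carrier A. \<exists>c. \<forall>f\<in>F. x \<otimes> f = c \<odot> f}"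
  then obtain c d where c: "\<forall>f\<in>F. x \<otimes> f = c \<odot> f" and d: "\<forall>f\<in>F. y \<otimes> f = d \<odot> f" by auto
  have "\<forall>f\<in>F. (x \<oplus> y) \<otimes> f = (c + d) \<odot> f" using F x y c d by (auto simp: l_distr add_scale)
  then show "x \<oplus> y \<in> {x \<in> carrier A. \<exists>c. \<forall>f\<in>F. x \<otimes> f = c \<odot> f}" using x y by auto
  have "\<forall>f\<in>F. (x \<otimes> y) \<otimes> f = (d * c) \<odot> f"
  proof
    fix f assume f: "f \<in> F"
    then have fc: "f \<in> carrier A" using F by auto
    have "(x \<otimes> y) \<otimes> f = x \<otimes> (d \<odot> f)" using x y f fc d by (simp add: m_assoc)
    also have "\<dots> = d \<odot> (x \<otimes> f)" using x fc by simp
    finally show "(x \<otimes> y) \<otimes> f = (d * c) \<odot> f" using c f fc by simp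
  qed
  then show "x \<otimes> y \<in> {x \<in> carrier A. \<exists>c. \<forall>f\<in>F. x \<otimes> f = c \<odot> f}" using x y by auto
next
  fix k x assume x: "x \<in> {x \<in> carrier A. \<exists>c. \<forall>f\<in>F. x \<otimes> f = c \<odot> f}"
  then obtain c where c: "\<forall>f\<in>F. x \<otimes> f = c \<odot> f" by auto
  have "\<forall>f\<in>F. (k \<odot> x) \<otimes> f = (k * c) \<odot> f" using F x c by (auto simp: subset_iff)
  then show "k \<odot> x \<in> {x \<in> carrier A. \<exists>c. \<forall>f\<in>F. x \<otimes> f = c \<odot> f}" using x by auto
qed auto

end

lemma unital_subalgebra_vimage:
  assumes "algebra_over A" "algebra_over B" "\<phi> \<in> algebra_hom A B" "unital_subalgebra H B"
  shows "unital_subalgebra {x \<in> carrier A. \<phi> x \<in> H} A"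
proof -
  interpret A: algebra_over A by fact
  interpret B: algebra_over B by fact
  show ?thesis
    by (rule A.unital_subalgebraI)
      (auto simp: algebra_homD[OF assms(3)] intro: B.unital_subalgebraD[OF assms(4)])
qed

locale mf_tower =
  fixes A :: "nat \<Rightarrow> ('k::field, 'a) module" and \<iota> :: "nat \<Rightarrow> 'a \<Rightarrow> 'a"
  assumes family: "multiplicity_free_family A \<iota>"

sublocale mf_tower \<subseteq> alg: split_semisimple_algebra "A n" for n
  using family by unfold_locales (simp add: multiplicity_free_family_def)

context mf_tower
begin

abbreviation E where "E \<equiv> eps_path A \<iota>"

lemma iota_hom: "\<iota> n \<in> algebra_hom (A n) (A (Suc n))"
  using family by (simp add: multiplicity_free_family_def)

lemmas iota_closed [simp, intro] = algebra_homD(1)[OF iota_hom]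
  and iota_mult = algebra_homD(2)[OF iota_hom]
  and iota_one [simp] = algebra_homD(4)[OF iota_hom]
  and iota_scale = algebra_homD(5)[OF iota_hom]
  and iota_zero [simp] = algebra_hom_zero[OF alg.algebra_over_axioms alg.algebra_over_axioms iota_hom]

lemma iota_sum:
  assumes "finite S" "f \<in> S \<rightarrow> carrier (A n)"
  shows "\<iota> n (\<Oplus>\<^bsub>A n\<^esub>s\<in>S. f s) = (\<Oplus>\<^bsub>A (Suc n)\<^esub>s\<in>S. \<iota> n (f s))"
proof -
  interpret ring_hom_ring "A n" "A (Suc n)" "\<iota> n"
    by (rule ring_hom_ringI2[OF alg.ring_axioms alg.ring_axioms]) (use iota_hom in \<open>simp add: algebra_hom_def\<close>)
  show ?thesis using hom_finsum[OF assms(2)] by (simp add: comp_def)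
qed

lemma incl_self [simp]: "incl \<iota> n n x = x"
  by (simp add: incl_def)

lemma incl_Suc: "k \<le> n \<Longrightarrow> incl \<iota> k (Suc n) x = \<iota> n (incl \<iota> k n x)"
  by (simp add: incl_def)

lemma incl_closed [simp, intro]: "k \<le> n \<Longrightarrow> x \<in> carrier (A k) \<Longrightarrow> incl \<iota> k n x \<in> carrier (A n)"
  by (induction n rule: dec_induct) (simp_all add: incl_Suc)

subsection \<open>The branching graph\<close>

text \<open>It suffices that the product annihilates \<open>V\<^sup>\<nu>\<close>.  Decompose the restriction of \<open>V\<^sup>\<nu>\<close> into irreducible
  modules, which is possible by the third axiom of a multiplicity-free family.  If \<open>\<epsilon>(\<mu>)\<close> did not
  annihilate one of them, this one would be isomorphic to \<open>V\<^sup>\<mu>\<close> and thus yield an edge.\<close>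

lemma non_edge_zero:
  assumes \<mu>: "\<mu> \<in> Irr (A n)" and \<nu>: "\<nu> \<in> Irr (A (Suc n))" and "\<not> branching_edge A \<iota> n \<mu> \<nu>"
  shows "\<iota> n (eps (A n) \<mu>) \<otimes>\<^bsub>A (Suc n)\<^esub> eps (A (Suc n)) \<nu> = \<zero>\<^bsub>A (Suc n)\<^esub>"
proof (rule alg.annihilator_eps[OF \<nu>])
  fix v assume v: "v \<in> carrier (irr_rep \<nu>)"
  let ?V = "irr_rep \<nu>"
  note irr = irreducible_irr_rep[OF \<nu>]
  note lV = left_module_restrict_scalars[OF alg.ring_axioms iota_hom irreducibleD(1)[OF irr]]
  obtain m :: nat and W :: "nat \<Rightarrow> ('a, 'a) module" where W: "\<And>i. i < m \<Longrightarrow> irreducible_module (A n) (W i)"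
    and iso: "module_isomorphic (A n) (restrict_scalars (\<iota> n) ?V) (family_sum {..<m} W)"
    using family irr unfolding multiplicity_free_family_def by blast
  obtain h where h: "h \<in> LinearCombinations.module_hom (A n) (restrict_scalars (\<iota> n) ?V) (family_sum {..<m} W)"
    and bij: "bij_betw h (carrier ?V) (carrier (family_sum {..<m} W))"
    using iso by (auto simp: module_isomorphic_def)
  let ?z = "\<iota> n (eps (A n) \<mu>) \<odot>\<^bsub>?V\<^esub> v"
  have zc: "?z \<in> carrier ?V" using v \<mu> left_moduleD(3)[OF irreducibleD(1)[OF irr]] by auto
  interpret V: abelian_group ?V using left_moduleD(2)[OF irreducibleD(1)[OF irr]] .
  have h_zero: "h \<zero>\<^bsub>?V\<^esub> i = \<zero>\<^bsub>W i\<^esub>" if "i < m" for i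
  proof (rule additive_zero[OF V.abelian_group_axioms left_moduleD(2)[OF irreducibleD(1)[OF W[OF that]]]])
    fix x y assume x: "x \<in> carrier ?V"
    show "h x i \<in> carrier (W i)" using module_homD(1)[OF h, of x] x that by (auto simp: family_sum_def)
    assume y: "y \<in> carrier ?V"
    show "h (x \<oplus>\<^bsub>?V\<^esub> y) i = h x i \<oplus>\<^bsub>W i\<^esub> h y i"
      using module_homD(2)[OF h, of x y] x y that by (simp add: family_sum_def)
  qed
  have "h ?z i = \<zero>\<^bsub>W i\<^esub>" if i: "i < m" for i
  proof (rule ccontr)
    assume nz: "h ?z i \<noteq> \<zero>\<^bsub>W i\<^esub>"
    have "h v i \<in> carrier (W i)" using module_homD(1)[OF h, of v] v i by (auto simp: family_sum_def)
    moreover have "h ?z i = eps (A n) \<mu> \<odot>\<^bsub>W i\<^esub> h v i"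
      using module_homD(3)[OF h, of "eps (A n) \<mu>" v] v i \<mu> by (simp add: family_sum_def)
    ultimately have "module_isomorphic (A n) (irr_rep \<mu>) (W i)"
      using alg.eps_acts_nonzero[OF \<mu> W[OF i]] nz by simp
    then have "branching_edge A \<iota> n \<mu> \<nu>"
      unfolding branching_edge_def using i irreducibleD(1)[OF W]
      by (intro family_sum_summand[OF lV _ iso, of i]) auto
    then show False using assms(3) by simp
  qed
  then have "h ?z = h \<zero>\<^bsub>?V\<^esub>"
    using module_homD(1)[OF h, of ?z] module_homD(1)[OF h, of "\<zero>\<^bsub>?V\<^esub>"] zc h_zero
    by (intro PiE_ext[of _ "{..<m}"]) (auto simp: family_sum_def)
  then show "?z = \<zero>\<^bsub>?V\<^esub>" using bij zc by (auto simp: bij_betw_def inj_on_def)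
qed (use \<mu> in auto)

text \<open>A field has no idempotents besides \<open>0\<close> and \<open>1\<close>.  The vertex \<open>\<lambda>\<^sub>0\<close> therefore makes no difference to
  the product over a path, and there is only one choice for it.\<close>

lemma eps_A0: assumes "\<nu> \<in> Irr (A 0)" shows "eps (A 0) \<nu> = \<one>\<^bsub>A 0\<^esub>"
proof -
  obtain f where f: "f \<in> algebra_hom (A 0) (ground_algebra :: ('k, 'k) module)"
    and bij: "bij_betw f (carrier (A 0)) (carrier (ground_algebra :: ('k, 'k) module))"
    using family by (auto simp: multiplicity_free_family_def algebra_isomorphic_def)
  have inj: "x = y" if "f x = f y" "x \<in> carrier (A 0)" "y \<in> carrier (A 0)" for x y
    using bij that by (auto simp: bij_betw_def inj_on_def)
  let ?x = "eps (A 0) \<nu>"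
  have "f ?x * f ?x = f ?x"
    using algebra_homD(2)[OF f, of ?x ?x] alg.eps_mult[OF assms assms] assms by (simp add: ground_algebra_def)
  moreover have "f \<zero>\<^bsub>A 0\<^esub> = 0"
    using algebra_homD(5)[OF f, of "\<one>\<^bsub>A 0\<^esub>" 0] by (simp add: ground_algebra_def)
  then have "f ?x \<noteq> 0" using inj[of ?x "\<zero>\<^bsub>A 0\<^esub>"] alg.eps_nonzero[OF assms] assms by auto
  ultimately have "f ?x = f \<one>\<^bsub>A 0\<^esub>" using algebra_homD(4)[OF f] by (simp add: ground_algebra_def)
  then show ?thesis using inj assms by blast
qed

lemma Tab_0: "T \<in> Tab A \<iota> 0 \<longleftrightarrow> (\<exists>\<nu>\<in>Irr (A 0). T = [\<nu>])"
  by (auto simp: Tab_def length_Suc_conv)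

lemma Tab_nonempty: "T \<in> Tab A \<iota> n \<Longrightarrow> T \<noteq> []"
  by (auto simp: Tab_def)

lemma Tab_length: "T \<in> Tab A \<iota> n \<Longrightarrow> length T = Suc n"
  by (simp add: Tab_def)

lemma last_Tab: "T \<in> Tab A \<iota> n \<Longrightarrow> last T \<in> Irr (A n)"
  using Tab_nonempty[of T n] by (auto simp: Tab_def last_conv_nth)

lemma Tab_snoc:
  "T @ [\<nu>] \<in> Tab A \<iota> (Suc n) \<longleftrightarrow>
    T \<in> Tab A \<iota> n \<and> \<nu> \<in> Irr (A (Suc n)) \<and> branching_edge A \<iota> n (last T) \<nu>"
proof (cases "length T = Suc n")
  case True
  then have "last T = T ! n" by (subst last_conv_nth) auto
  moreover have "(\<forall>k\<le>Suc n. (T @ [\<nu>]) ! k \<in> Irr (A k)) \<longleftrightarrow>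
      (\<forall>k\<le>n. T ! k \<in> Irr (A k)) \<and> \<nu> \<in> Irr (A (Suc n))"
    using True by (fastforce simp: nth_append le_Suc_eq)
  ultimately show ?thesis using True
    by (auto simp: Tab_def All_less_Suc nth_append)
qed (auto simp: Tab_def)

lemma Tab_Suc_cases:
  assumes "S \<in> Tab A \<iota> (Suc n)"
  obtains T \<nu> where "S = T @ [\<nu>]" "T \<in> Tab A \<iota> n" "\<nu> \<in> Irr (A (Suc n))" "branching_edge A \<iota> n (last T) \<nu>"
proof -
  have "S = butlast S @ [last S]" using Tab_nonempty[OF assms] by simp
  then show ?thesis using that assms Tab_snoc by metis
qed

lemma Tab_take:
  assumes "T \<in> Tab A \<iota> n" "k \<le> n" shows "take (Suc k) T \<in> Tab A \<iota> k"
  using assms by (auto simp: Tab_def)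

lemma finite_Tab: "finite (Tab A \<iota> n)"
proof (induction n)
  case 0
  have "Tab A \<iota> 0 = (\<lambda>\<nu>. [\<nu>]) ` Irr (A 0)" using Tab_0 by auto
  then show ?case using alg.finite_Irr by simp
next
  case (Suc n)
  have "Tab A \<iota> (Suc n) \<subseteq> (\<lambda>(T, \<nu>). T @ [\<nu>]) ` (Tab A \<iota> n \<times> Irr (A (Suc n)))"
    by (auto elim!: Tab_Suc_cases)
  then show ?case using Suc alg.finite_Irr finite_subset by blast
qed

subsection \<open>Orthogonality and completeness\<close>

lemma foldr_mult_snoc:
  assumes "set xs \<subseteq> carrier (A n)" "y \<in> carrier (A n)"
  shows "foldr (mult (A n)) xs \<one>\<^bsub>A n\<^esub> \<in> carrier (A n)"
    and "foldr (mult (A n)) (xs @ [y]) \<one>\<^bsub>A n\<^esub> = foldr (mult (A n)) xs \<one>\<^bsub>A n\<^esub> \<otimes>\<^bsub>A n\<^esub> y"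
proof -
  have "foldr (mult (A n)) xs \<one>\<^bsub>A n\<^esub> \<in> carrier (A n) \<and>
    foldr (mult (A n)) xs y = foldr (mult (A n)) xs \<one>\<^bsub>A n\<^esub> \<otimes>\<^bsub>A n\<^esub> y"
    using assms by (induction xs) (auto simp: alg.m_assoc)
  then show "foldr (mult (A n)) xs \<one>\<^bsub>A n\<^esub> \<in> carrier (A n)"
    and "foldr (mult (A n)) (xs @ [y]) \<one>\<^bsub>A n\<^esub> = foldr (mult (A n)) xs \<one>\<^bsub>A n\<^esub> \<otimes>\<^bsub>A n\<^esub> y"
    using assms by auto
qed

lemma iota_foldr_mult:
  "set xs \<subseteq> carrier (A n) \<Longrightarrow>
    \<iota> n (foldr (mult (A n)) xs \<one>\<^bsub>A n\<^esub>) = foldr (mult (A (Suc n))) (map (\<iota> n) xs) \<one>\<^bsub>A (Suc n)\<^esub>"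
  by (induction xs) (auto simp: iota_mult foldr_mult_snoc(1)[OF _ alg.one_closed])

lemma eps_path_0: "T \<in> Tab A \<iota> 0 \<Longrightarrow> E T = \<one>\<^bsub>A 0\<^esub>"
  by (auto simp: eps_path_def Tab_def)

lemma eps_path_closed: assumes "T \<in> Tab A \<iota> n" shows "E T \<in> carrier (A n)"
  unfolding eps_path_def Let_def Tab_length[OF assms] diff_Suc_1
  by (rule foldr_mult_snoc(1)[OF _ alg.one_closed]) (use assms in \<open>auto simp: Tab_def\<close>)

text \<open>The embedding is multiplicative and so passes through the ordered product over the shorter path.\<close>

lemma eps_path_snoc:
  assumes "T \<in> Tab A \<iota> n" "\<nu> \<in> Irr (A (Suc n))"
  shows "E (T @ [\<nu>]) = \<iota> n (E T) \<otimes>\<^bsub>A (Suc n)\<^esub> eps (A (Suc n)) \<nu>"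
proof -
  let ?g = "\<lambda>T n k. incl \<iota> k n (eps (A k) (T ! k))"
  have len: "length T = Suc n" and irr: "\<And>k. k \<le> n \<Longrightarrow> T ! k \<in> Irr (A k)" using assms by (auto simp: Tab_def)
  have "map (?g (T @ [\<nu>]) (Suc n)) [1..<Suc (Suc n)]
      = map (\<iota> n) (map (?g T n) [1..<Suc n]) @ [eps (A (Suc n)) \<nu>]"
    using len by (auto simp: nth_append incl_Suc)
  moreover have "set (map (?g T n) [1..<Suc n]) \<subseteq> carrier (A n)" using irr by auto
  moreover from this have "set (map (\<iota> n) (map (?g T n) [1..<Suc n])) \<subseteq> carrier (A (Suc n))" by auto
  ultimately show ?thesis
    using assms(2) len unfolding eps_path_def Let_def
    by (simp only: length_append_singleton diff_Suc_1 foldr_mult_snoc(2)[OF _ alg.eps_closed] iota_foldr_mult)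
qed

lemma eps_path_last:
  assumes "T \<in> Tab A \<iota> n" shows "E T \<otimes>\<^bsub>A n\<^esub> eps (A n) (last T) = E T"
proof (cases n)
  case 0
  then show ?thesis using assms eps_A0[of "last T"] last_Tab[OF assms] eps_path_closed[OF assms] by simp
next
  case (Suc m)
  then obtain S \<nu> where T: "T = S @ [\<nu>]" "S \<in> Tab A \<iota> m" "\<nu> \<in> Irr (A (Suc m))"
    using assms Tab_Suc_cases by metis
  then show ?thesis using Suc eps_path_closed[OF T(2)]
    by (simp add: eps_path_snoc alg.m_assoc alg.eps_mult)
qed

lemma iota_eps_path_mult:
  assumes T: "T @ [\<nu>] \<in> Tab A \<iota> (Suc n)" and x: "x \<in> carrier (A n)"
  shows "\<iota> n x \<otimes>\<^bsub>A (Suc n)\<^esub> E (T @ [\<nu>]) = \<iota> n (x \<otimes>\<^bsub>A n\<^esub> E T) \<otimes>\<^bsub>A (Suc n)\<^esub> eps (A (Suc n)) \<nu>"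
proof -
  have "T \<in> Tab A \<iota> n" "\<nu> \<in> Irr (A (Suc n))" using T Tab_snoc by auto
  then show ?thesis using eps_path_closed[of T n] x by (simp add: eps_path_snoc iota_mult alg.m_assoc)
qed

text \<open>By the recursion \<open>E S \<otimes> E T = \<iota>(E S' \<otimes> E T') \<epsilon>(\<mu>) \<epsilon>(\<nu>)\<close>, as \<open>\<epsilon>(\<mu>)\<close> is central.\<close>

lemma eps_path_mult:
  assumes "S \<in> Tab A \<iota> n" "T \<in> Tab A \<iota> n"
  shows "E S \<otimes>\<^bsub>A n\<^esub> E T = (if S = T then E S else \<zero>\<^bsub>A n\<^esub>)"
  using assms
proof (induction n arbitrary: S T)
  case 0
  obtain \<nu> \<mu> where \<nu>: "S = [\<nu>]" "\<nu> \<in> Irr (A 0)" and \<mu>: "T = [\<mu>]" "\<mu> \<in> Irr (A 0)" using 0 Tab_0 by auto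
  have "\<nu> = \<mu>"
    using alg.eps_mult[OF \<nu>(2) \<mu>(2)] alg.eps_nonzero[OF \<nu>(2)] eps_A0[OF \<nu>(2)] eps_A0[OF \<mu>(2)]
    by (auto split: if_splits)
  then show ?case using 0 \<nu> \<mu> eps_path_0 by simp
next
  case (Suc n)
  obtain S' \<mu> where S: "S = S' @ [\<mu>]" "S' \<in> Tab A \<iota> n" "\<mu> \<in> Irr (A (Suc n))"
    using Suc.prems(1) by (rule Tab_Suc_cases)
  obtain T' \<nu> where T: "T = T' @ [\<nu>]" "T' \<in> Tab A \<iota> n" "\<nu> \<in> Irr (A (Suc n))"
    using Suc.prems(2) by (rule Tab_Suc_cases)
  note c = eps_path_closed[OF S(2)] eps_path_closed[OF T(2)]
  have "E S \<otimes>\<^bsub>A (Suc n)\<^esub> E T = \<iota> n (E S') \<otimes>\<^bsub>A (Suc n)\<^esub>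
      (eps (A (Suc n)) \<mu> \<otimes>\<^bsub>A (Suc n)\<^esub> \<iota> n (E T')) \<otimes>\<^bsub>A (Suc n)\<^esub> eps (A (Suc n)) \<nu>"
    using S T c by (simp add: eps_path_snoc alg.m_assoc)
  also have "\<dots> = \<iota> n (E S' \<otimes>\<^bsub>A n\<^esub> E T') \<otimes>\<^bsub>A (Suc n)\<^esub> (eps (A (Suc n)) \<mu> \<otimes>\<^bsub>A (Suc n)\<^esub> eps (A (Suc n)) \<nu>)"
    using S T c alg.centre_commutes[OF alg.eps_centre[OF S(3)], of "\<iota> n (E T')"]
    by (simp add: iota_mult alg.m_assoc)
  finally show ?case
    using S T c Suc.IH[OF S(2) T(2)] by (auto simp: alg.eps_mult eps_path_snoc)
qed

text \<open>An element \<open>x\<close> annihilated by all \<open>E T\<close> is annihilated by all \<open>\<iota>(E S) \<epsilon>(\<nu>)\<close>: for an edge this is a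
  path idempotent, otherwise the product is zero because \<open>\<epsilon>\<close> of the last vertex of \<open>S\<close> is a factor
  of \<open>E S\<close>.  Summation over \<open>\<nu>\<close> and, by the induction hypothesis, over \<open>S\<close> gives \<open>x = 0\<close>.\<close>

lemma eps_path_sum: "(\<Oplus>\<^bsub>A n\<^esub>T\<in>Tab A \<iota> n. E T) = \<one>\<^bsub>A n\<^esub>"
proof (induction n)
  case 0
  show ?case
  proof (rule alg.sum_one_if_detecting[OF finite_Tab eps_path_closed eps_path_mult])
    fix x assume x: "x \<in> carrier (A 0)" "\<And>T. T \<in> Tab A \<iota> 0 \<Longrightarrow> x \<otimes>\<^bsub>A 0\<^esub> E T = \<zero>\<^bsub>A 0\<^esub>"
    show "x = \<zero>\<^bsub>A 0\<^esub>"
    proof (rule alg.eps_detect[OF x(1)])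
      fix \<nu> assume "\<nu> \<in> Irr (A 0)"
      then show "x \<otimes>\<^bsub>A 0\<^esub> eps (A 0) \<nu> = \<zero>\<^bsub>A 0\<^esub>" using x(2)[of "[\<nu>]"] Tab_0[of "[\<nu>]"] eps_path_0 eps_A0 by simp
    qed
  qed
next
  case (Suc n)
  show ?case
  proof (rule alg.sum_one_if_detecting[OF finite_Tab eps_path_closed eps_path_mult])
    fix x assume x: "x \<in> carrier (A (Suc n))"
      "\<And>T. T \<in> Tab A \<iota> (Suc n) \<Longrightarrow> x \<otimes>\<^bsub>A (Suc n)\<^esub> E T = \<zero>\<^bsub>A (Suc n)\<^esub>"
    show "x = \<zero>\<^bsub>A (Suc n)\<^esub>"
    proof (rule alg.detecting_if_sum_one[OF finite_Tab _ _ x(1)])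
      show "(\<Oplus>\<^bsub>A (Suc n)\<^esub>T\<in>Tab A \<iota> n. \<iota> n (E T)) = \<one>\<^bsub>A (Suc n)\<^esub>"
        using iota_sum[OF finite_Tab, of E n n] Suc eps_path_closed by simp
    next
      fix T assume T: "T \<in> Tab A \<iota> n"
      note Tc = eps_path_closed[OF T]
      show "\<iota> n (E T) \<in> carrier (A (Suc n))" using Tc by simp
      show "x \<otimes>\<^bsub>A (Suc n)\<^esub> \<iota> n (E T) = \<zero>\<^bsub>A (Suc n)\<^esub>"
      proof (rule alg.eps_detect)
        fix \<nu> assume \<nu>: "\<nu> \<in> Irr (A (Suc n))"
        show "x \<otimes>\<^bsub>A (Suc n)\<^esub> \<iota> n (E T) \<otimes>\<^bsub>A (Suc n)\<^esub> eps (A (Suc n)) \<nu> = \<zero>\<^bsub>A (Suc n)\<^esub>"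
        proof (cases "branching_edge A \<iota> n (last T) \<nu>")
          case True
          then have "T @ [\<nu>] \<in> Tab A \<iota> (Suc n)" using T \<nu> Tab_snoc by simp
          then show ?thesis using x(2)[of "T @ [\<nu>]"] T \<nu> x(1) Tc by (simp add: eps_path_snoc alg.m_assoc)
        next
          case False
          note l = last_Tab[OF T]
          have "\<iota> n (E T) = \<iota> n (E T) \<otimes>\<^bsub>A (Suc n)\<^esub> \<iota> n (eps (A n) (last T))"
            using eps_path_last[OF T] iota_mult[OF Tc, of "eps (A n) (last T)"] l by simp
          then have "\<iota> n (E T) \<otimes>\<^bsub>A (Suc n)\<^esub> eps (A (Suc n)) \<nu> =
            \<iota> n (E T) \<otimes>\<^bsub>A (Suc n)\<^esub> (\<iota> n (eps (A n) (last T)) \<otimes>\<^bsub>A (Suc n)\<^esub> eps (A (Suc n)) \<nu>)"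
            using Tc \<nu> l by (metis alg.eps_closed alg.m_assoc iota_closed)
          then show ?thesis using non_edge_zero[OF l \<nu> False] x(1) Tc \<nu> by (simp add: alg.m_assoc)
        qed
      qed (use x Tc in auto)
    qed
  qed
qed

lemma path_ext:
  assumes "x \<in> carrier (A n)" "y \<in> carrier (A n)"
    and "\<And>T. T \<in> Tab A \<iota> n \<Longrightarrow> x \<otimes>\<^bsub>A n\<^esub> E T = y \<otimes>\<^bsub>A n\<^esub> E T"
  shows "x = y"
proof -
  have "x \<ominus>\<^bsub>A n\<^esub> y = \<zero>\<^bsub>A n\<^esub>"
  proof (rule alg.detecting_if_sum_one[OF finite_Tab eps_path_closed eps_path_sum])
    fix T assume "T \<in> Tab A \<iota> n"
    then show "(x \<ominus>\<^bsub>A n\<^esub> y) \<otimes>\<^bsub>A n\<^esub> E T = \<zero>\<^bsub>A n\<^esub>"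
      using assms eps_path_closed by (simp add: alg.minus_eq alg.l_distr alg.l_minus alg.r_neg)
  qed (use assms in auto)
  then show ?thesis using assms(1,2) by simp
qed

text \<open>If \<open>E S\<close> does not annihilate \<open>v \<in> V\<^sup>\<mu>\<close>, then \<open>E T\<close> does not annihilate the image of \<open>v\<close> under the
  embedding of \<open>V\<^sup>\<mu>\<close> into \<open>V\<^sup>\<nu>\<close> given by the edge, because \<open>\<epsilon>(\<nu>)\<close> acts as the identity there.\<close>

lemma eps_path_acts_nonzero:
  assumes "T \<in> Tab A \<iota> n"
  shows "\<exists>v\<in>carrier (irr_rep (last T)). E T \<odot>\<^bsub>irr_rep (last T)\<^esub> v \<noteq> \<zero>\<^bsub>irr_rep (last T)\<^esub>"
  using assms
proof (induction n arbitrary: T)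
  case 0
  note irr = irreducible_irr_rep[OF last_Tab[OF 0]]
  show ?case using irreducible_nonzero[OF irr] left_moduleD(7)[OF irreducibleD(1)[OF irr]] eps_path_0[OF 0] by metis
next
  case (Suc n)
  obtain S \<nu> where S: "T = S @ [\<nu>]" "S \<in> Tab A \<iota> n" "\<nu> \<in> Irr (A (Suc n))" "branching_edge A \<iota> n (last S) \<nu>"
    using Suc.prems by (rule Tab_Suc_cases)
  let ?M = "irr_rep (last S)" and ?V = "irr_rep \<nu>"
  obtain v where v: "v \<in> carrier ?M" "E S \<odot>\<^bsub>?M\<^esub> v \<noteq> \<zero>\<^bsub>?M\<^esub>" using Suc.IH[OF S(2)] by blast
  obtain U where U: "left_submodule (A n) U (restrict_scalars (\<iota> n) ?V)"
    and "module_isomorphic (A n) ?M ((restrict_scalars (\<iota> n) ?V)\<lparr>carrier := U\<rparr>)"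
    using S(4) unfolding branching_edge_def isomorphic_to_summand_def by blast
  then obtain g where g: "g \<in> LinearCombinations.module_hom (A n) ?M ((restrict_scalars (\<iota> n) ?V)\<lparr>carrier := U\<rparr>)"
    and inj: "inj_on g (carrier ?M)"
    by (auto simp: module_isomorphic_def bij_betw_def)
  have lM: "left_module (A n) ?M" and lV: "left_module (A (Suc n)) ?V"
    using irreducible_irr_rep[OF last_Tab[OF S(2)]] irreducible_irr_rep[OF S(3)] irreducibleD(1) by auto
  interpret M: abelian_group ?M using left_moduleD(2)[OF lM] .
  have gV: "g x \<in> carrier ?V" if "x \<in> carrier ?M" for x
    using module_homD(1)[OF g that] left_submoduleD(1)[OF U] by auto
  have gs: "g (a \<odot>\<^bsub>?M\<^esub> x) = \<iota> n a \<odot>\<^bsub>?V\<^esub> g x" if "a \<in> carrier (A n)" "x \<in> carrier ?M" for a x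
    using module_homD(3)[OF g that] by simp
  have g0: "g \<zero>\<^bsub>?M\<^esub> = \<zero>\<^bsub>?V\<^esub>"
    using gs[of "\<zero>\<^bsub>A n\<^esub>" "\<zero>\<^bsub>?M\<^esub>"] left_module_zero_smult[OF lM, of "\<zero>\<^bsub>?M\<^esub>"]
      left_module_zero_smult[OF lV, of "g \<zero>\<^bsub>?M\<^esub>"] gV by simp
  note Sc = eps_path_closed[OF S(2)]
  have "E T \<odot>\<^bsub>?V\<^esub> g v = \<iota> n (E S) \<odot>\<^bsub>?V\<^esub> (eps (A (Suc n)) \<nu> \<odot>\<^bsub>?V\<^esub> g v)"
    using S Sc gV[OF v(1)] by (simp add: eps_path_snoc left_moduleD(6)[OF lV])
  also have "\<dots> = g (E S \<odot>\<^bsub>?M\<^esub> v)" using gs[OF Sc v(1)] alg.eps_acts_one[OF S(3) gV[OF v(1)]] by simp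
  also have "\<dots> \<noteq> \<zero>\<^bsub>?V\<^esub>"
    using v inj g0 left_moduleD(3)[OF lM Sc v(1)] by (auto dest!: inj_onD[of g _ "E S \<odot>\<^bsub>?M\<^esub> v" "\<zero>\<^bsub>?M\<^esub>"])
  finally show ?case using S(1) gV[OF v(1)] by auto
qed

lemma eps_path_nonzero: assumes "T \<in> Tab A \<iota> n" shows "E T \<noteq> \<zero>\<^bsub>A n\<^esub>"
  using eps_path_acts_nonzero[OF assms] irreducible_irr_rep[OF last_Tab[OF assms]]
    left_module_zero_smult irreducibleD(1) by metis

end

context mf_tower
begin

section \<open>The Gelfand-Zetlin subalgebras\<close>

lemma GZ_generators:
  "(\<Union>k\<in>{1..n}. incl \<iota> k n ` centre (A k)) \<subseteq> carrier (A n)"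
  by auto

lemma GZ_subalgebra: "unital_subalgebra (GZ A \<iota> n) (A n)"
  unfolding GZ_def by (rule alg.unital_subalgebra_generated[OF GZ_generators])

lemmas GZ_D = alg.unital_subalgebraD[OF GZ_subalgebra]

lemma GZ_closed [simp]: "x \<in> GZ A \<iota> n \<Longrightarrow> x \<in> carrier (A n)"
  using GZ_D(1) by blast

lemma iota_GZ: assumes "x \<in> GZ A \<iota> n" shows "\<iota> n x \<in> GZ A \<iota> (Suc n)"
proof -
  let ?H = "{x \<in> carrier (A n). \<iota> n x \<in> GZ A \<iota> (Suc n)}"
  have "GZ A \<iota> n \<subseteq> ?H"
    unfolding GZ_def[of A \<iota> n]
  proof (rule alg.generated_subalgebra_least)
    show "unital_subalgebra ?H (A n)"
      by (rule unital_subalgebra_vimage[OF alg.algebra_over_axioms alg.algebra_over_axioms iota_hom GZ_subalgebra])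
    have "\<iota> n (incl \<iota> k n z) \<in> GZ A \<iota> (Suc n)" if "k \<in> {1..n}" "z \<in> centre (A k)" for k z
    proof -
      have "incl \<iota> k (Suc n) z \<in> (\<Union>k\<in>{1..Suc n}. incl \<iota> k (Suc n) ` centre (A k))" using that by auto
      then have "incl \<iota> k (Suc n) z \<in> GZ A \<iota> (Suc n)"
        unfolding GZ_def by (rule subsetD[OF alg.generated_subalgebra_incl])
      then show ?thesis using that by (simp add: incl_Suc)
    qed
    then show "(\<Union>k\<in>{1..n}. incl \<iota> k n ` centre (A k)) \<subseteq> ?H"
      using GZ_generators[of n] by blast
  qed
  then show ?thesis using assms by auto
qed

lemma incl_GZ: "k \<le> n \<Longrightarrow> x \<in> GZ A \<iota> k \<Longrightarrow> incl \<iota> k n x \<in> GZ A \<iota> n"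
  by (induction n rule: dec_induct) (simp_all add: incl_Suc iota_GZ)

lemma eps_path_GZ: "T \<in> Tab A \<iota> n \<Longrightarrow> E T \<in> GZ A \<iota> n"
proof (induction n arbitrary: T)
  case 0
  then show ?case using GZ_D(2) eps_path_0 by simp
next
  case (Suc n)
  obtain S \<nu> where S: "T = S @ [\<nu>]" "S \<in> Tab A \<iota> n" "\<nu> \<in> Irr (A (Suc n))"
    using Suc.prems by (rule Tab_Suc_cases)
  have "eps (A (Suc n)) \<nu> = incl \<iota> (Suc n) (Suc n) (eps (A (Suc n)) \<nu>)" by simp
  then have "eps (A (Suc n)) \<nu> \<in> (\<Union>k\<in>{1..Suc n}. incl \<iota> k (Suc n) ` centre (A k))"
    using alg.eps_centre[OF S(3)] by fastforce
  then have "eps (A (Suc n)) \<nu> \<in> GZ A \<iota> (Suc n)"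
    unfolding GZ_def by (rule subsetD[OF alg.generated_subalgebra_incl])
  then show ?case using GZ_D(5) iota_GZ[OF Suc.IH[OF S(2)]] S by (simp add: eps_path_snoc)
qed

lemma iota_eigen:
  assumes "y \<in> carrier (A n)" "T @ [\<nu>] \<in> Tab A \<iota> (Suc n)" "y \<otimes>\<^bsub>A n\<^esub> E T = c \<odot>\<^bsub>A n\<^esub> E T"
  shows "\<iota> n y \<otimes>\<^bsub>A (Suc n)\<^esub> E (T @ [\<nu>]) = c \<odot>\<^bsub>A (Suc n)\<^esub> E (T @ [\<nu>])"
proof -
  have T: "T \<in> Tab A \<iota> n" "\<nu> \<in> Irr (A (Suc n))" using assms(2) Tab_snoc by auto
  then show ?thesis using iota_eps_path_mult[OF assms(2,1)] assms(3) eps_path_closed[OF T(1)]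
    by (simp add: eps_path_snoc iota_scale)
qed

text \<open>For a generator \<open>z\<close>, central in \<open>A\<^sub>k\<close>, only the factor \<open>\<epsilon>(\<lambda>\<^sub>k)\<close> of the path idempotent matters, and
  \<open>z \<epsilon>(\<lambda>\<^sub>k)\<close> is a scalar multiple of \<open>\<epsilon>(\<lambda>\<^sub>k)\<close>.\<close>

lemma GZ_eigen:
  assumes x: "x \<in> GZ A \<iota> n" and T: "T \<in> Tab A \<iota> n"
  shows "\<exists>c. x \<otimes>\<^bsub>A n\<^esub> E T = c \<odot>\<^bsub>A n\<^esub> E T"
proof -
  let ?H = "{x \<in> carrier (A n). \<exists>c. \<forall>f\<in>{E T}. x \<otimes>\<^bsub>A n\<^esub> f = c \<odot>\<^bsub>A n\<^esub> f}"
  have centre: "\<exists>c. incl \<iota> k n z \<otimes>\<^bsub>A n\<^esub> E T = c \<odot>\<^bsub>A n\<^esub> E T"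
    if "k \<le> n" and z: "z \<in> centre (A k)" and "T \<in> Tab A \<iota> n" for k z n T
    using that(1,3)
  proof (induction n arbitrary: T rule: dec_induct)
    case base
    note T = last_Tab[OF base] eps_path_closed[OF base] eps_path_last[OF base]
    obtain c where c: "z \<otimes>\<^bsub>A k\<^esub> eps (A k) (last T) = c \<odot>\<^bsub>A k\<^esub> eps (A k) (last T)"
      using alg.centre_eps[OF z T(1)] by blast
    have zc: "z \<in> carrier (A k)" using alg.centre_closed[OF z] .
    have "z \<otimes>\<^bsub>A k\<^esub> E T = E T \<otimes>\<^bsub>A k\<^esub> z" using alg.centre_commutes[OF z T(2)] .
    also have "\<dots> = E T \<otimes>\<^bsub>A k\<^esub> (eps (A k) (last T) \<otimes>\<^bsub>A k\<^esub> z)"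
      using alg.m_assoc[OF T(2) alg.eps_closed[OF T(1)] zc] T(3) by simp
    also have "\<dots> = E T \<otimes>\<^bsub>A k\<^esub> (c \<odot>\<^bsub>A k\<^esub> eps (A k) (last T))"
      using c alg.centre_commutes[OF z alg.eps_closed[OF T(1)]] by simp
    also have "\<dots> = c \<odot>\<^bsub>A k\<^esub> E T" using T by simp
    finally show ?case by auto
  next
    case (step n)
    obtain S \<nu> where S: "T = S @ [\<nu>]" "S \<in> Tab A \<iota> n"
      using step.prems by (rule Tab_Suc_cases)
    obtain c where "incl \<iota> k n z \<otimes>\<^bsub>A n\<^esub> E S = c \<odot>\<^bsub>A n\<^esub> E S" using step.IH[OF S(2)] by blast
    then show ?case
      using iota_eigen[of "incl \<iota> k n z" n S \<nu> c] step.prems step.hyps S(1) alg.centre_closed[OF z]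
      by (auto simp: incl_Suc)
  qed
  have "GZ A \<iota> n \<subseteq> ?H"
    unfolding GZ_def
  proof (rule alg.generated_subalgebra_least)
    show "unital_subalgebra ?H (A n)"
      by (rule alg.unital_subalgebra_eigen) (use eps_path_closed[OF T] in simp)
    show "(\<Union>k\<in>{1..n}. incl \<iota> k n ` centre (A k)) \<subseteq> ?H"
      using centre[OF _ _ T] by auto
  qed
  then show ?thesis using x by auto
qed

lemma GZ_commute:
  assumes x: "x \<in> GZ A \<iota> n" and y: "y \<in> GZ A \<iota> n"
  shows "x \<otimes>\<^bsub>A n\<^esub> y = y \<otimes>\<^bsub>A n\<^esub> x"
proof (rule path_ext)
  fix T assume T: "T \<in> Tab A \<iota> n"
  obtain c d where "x \<otimes>\<^bsub>A n\<^esub> E T = c \<odot>\<^bsub>A n\<^esub> E T" "y \<otimes>\<^bsub>A n\<^esub> E T = d \<odot>\<^bsub>A n\<^esub> E T"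
    using GZ_eigen[OF x T] GZ_eigen[OF y T] by blast
  then show "x \<otimes>\<^bsub>A n\<^esub> y \<otimes>\<^bsub>A n\<^esub> E T = y \<otimes>\<^bsub>A n\<^esub> x \<otimes>\<^bsub>A n\<^esub> E T"
    using x y eps_path_closed[OF T] by (simp add: alg.m_assoc mult.commute)
qed (use x y in auto)

lemma GZ_algebra_simps [simp]:
  "carrier (GZ_algebra A \<iota> n) = GZ A \<iota> n" "mult (GZ_algebra A \<iota> n) = mult (A n)"
  "one (GZ_algebra A \<iota> n) = one (A n)"
  by (simp_all add: GZ_algebra_def)

lemma GZ_comm_monoid: "comm_monoid (GZ_algebra A \<iota> n)"
  by (rule comm_monoidI) (auto simp: GZ_D alg.m_assoc intro: GZ_commute)

lemma iota_finprod:
  assumes "finite K" "\<And>k. k \<in> K \<Longrightarrow> f k \<in> GZ A \<iota> n"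
  shows "\<iota> n (\<Otimes>\<^bsub>GZ_algebra A \<iota> n\<^esub>k\<in>K. f k) = (\<Otimes>\<^bsub>GZ_algebra A \<iota> (Suc n)\<^esub>k\<in>K. \<iota> n (f k))"
proof -
  interpret M: comm_monoid "GZ_algebra A \<iota> n" by (rule GZ_comm_monoid)
  interpret N: comm_monoid "GZ_algebra A \<iota> (Suc n)" by (rule GZ_comm_monoid)
  show ?thesis using assms
  proof (induction K rule: finite_induct)
    case (insert k K)
    have "finprod (GZ_algebra A \<iota> n) f K \<in> GZ A \<iota> n"
      using M.finprod_closed[of f K] insert.prems by auto
    moreover have "f \<in> K \<rightarrow> carrier (GZ_algebra A \<iota> n)" "(\<lambda>k. \<iota> n (f k)) \<in> K \<rightarrow> carrier (GZ_algebra A \<iota> (Suc n))"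
      using insert.prems iota_GZ by auto
    ultimately show ?case
      using insert iota_GZ by (simp add: M.finprod_insert N.finprod_insert iota_mult)
  qed simp
qed

lemma finprod_eigen:
  assumes "finite K" "\<And>k. k \<in> K \<Longrightarrow> f k \<in> GZ A \<iota> n" "x \<in> carrier (A n)"
    and "\<And>k. k \<in> K \<Longrightarrow> f k \<otimes>\<^bsub>A n\<^esub> x = c k \<odot>\<^bsub>A n\<^esub> x"
  shows "(\<Otimes>\<^bsub>GZ_algebra A \<iota> n\<^esub>k\<in>K. f k) \<otimes>\<^bsub>A n\<^esub> x = (\<Prod>k\<in>K. c k) \<odot>\<^bsub>A n\<^esub> x"
proof -
  interpret M: comm_monoid "GZ_algebra A \<iota> n" by (rule GZ_comm_monoid)
  show ?thesis using assms(1,2,4)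
  proof (induction K rule: finite_induct)
    case (insert k K)
    have "finprod (GZ_algebra A \<iota> n) f K \<in> GZ A \<iota> n"
      using M.finprod_closed[of f K] insert.prems by auto
    moreover have "f \<in> K \<rightarrow> carrier (GZ_algebra A \<iota> n)" using insert.prems by auto
    ultimately show ?case
      using insert assms(3) by (simp add: M.finprod_insert alg.m_assoc mult.commute)
  qed (simp add: assms(3))
qed

section \<open>Contents and interpolation\<close>

text \<open>The coordinates of an element are the scalars by which it acts on the path idempotents.  This is
  also why coordinates exist and are unique, as the definite description in \<^const>\<open>path_coords\<close>
  requires.\<close>

lemma path_coords_eigen:
  assumes x: "incl \<iota> k n (J k) \<in> GZ A \<iota> n" and T: "T \<in> Tab A \<iota> n"
  shows "incl \<iota> k n (J k) \<otimes>\<^bsub>A n\<^esub> E T = path_coords A \<iota> J n k T \<odot>\<^bsub>A n\<^esub> E T"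
proof -
  let ?x = "incl \<iota> k n (J k)"
  let ?P = "\<lambda>c. c \<in> extensional (Tab A \<iota> n) \<and> ?x = (\<Oplus>\<^bsub>A n\<^esub>T\<in>Tab A \<iota> n. c T \<odot>\<^bsub>A n\<^esub> E T)"
  have sum: "(\<Oplus>\<^bsub>A n\<^esub>S\<in>Tab A \<iota> n. c S \<odot>\<^bsub>A n\<^esub> E S) \<otimes>\<^bsub>A n\<^esub> E T = c T \<odot>\<^bsub>A n\<^esub> E T"
    if T: "T \<in> Tab A \<iota> n" for c T
  proof -
    have "(\<Oplus>\<^bsub>A n\<^esub>S\<in>Tab A \<iota> n. c S \<odot>\<^bsub>A n\<^esub> E S) \<otimes>\<^bsub>A n\<^esub> E T
        = (\<Oplus>\<^bsub>A n\<^esub>S\<in>Tab A \<iota> n. (c S \<odot>\<^bsub>A n\<^esub> E S) \<otimes>\<^bsub>A n\<^esub> E T)"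
      using eps_path_closed T by (intro alg.finsum_ldistr finite_Tab) auto
    also have "\<dots> = (\<Oplus>\<^bsub>A n\<^esub>S\<in>Tab A \<iota> n. if T = S then c S \<odot>\<^bsub>A n\<^esub> E S else \<zero>\<^bsub>A n\<^esub>)"
      using eps_path_closed T by (intro alg.finsum_cong') (auto simp: eps_path_mult)
    also have "\<dots> = c T \<odot>\<^bsub>A n\<^esub> E T"
      using eps_path_closed by (intro alg.finsum_singleton[OF T finite_Tab]) auto
    finally show ?thesis .
  qed
  obtain d where d: "\<And>T. T \<in> Tab A \<iota> n \<Longrightarrow> ?x \<otimes>\<^bsub>A n\<^esub> E T = d T \<odot>\<^bsub>A n\<^esub> E T"
    using GZ_eigen[OF x] by metis
  have "path_coords A \<iota> J n k = restrict d (Tab A \<iota> n)"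
    unfolding path_coords_def
  proof (rule the_equality)
    have "?x = (\<Oplus>\<^bsub>A n\<^esub>T\<in>Tab A \<iota> n. restrict d (Tab A \<iota> n) T \<odot>\<^bsub>A n\<^esub> E T)"
    proof (rule path_ext)
      show "(\<Oplus>\<^bsub>A n\<^esub>T\<in>Tab A \<iota> n. restrict d (Tab A \<iota> n) T \<odot>\<^bsub>A n\<^esub> E T) \<in> carrier (A n)"
        using eps_path_closed by (intro alg.finsum_closed) auto
    qed (use x sum[of _ "restrict d (Tab A \<iota> n)"] d in auto)
    then show "?P (restrict d (Tab A \<iota> n))" by simp
  next
    fix c assume c: "?P c"
    have "c T = d T" if T: "T \<in> Tab A \<iota> n" for T
      using sum[OF T, of c] c d[OF T] alg.scale_inject[OF eps_path_closed[OF T] eps_path_nonzero[OF T], of "c T" "d T"]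
      by auto
    then show "c = restrict d (Tab A \<iota> n)" using c by (intro extensionalityI[of _ "Tab A \<iota> n"]) auto
  qed
  then show ?thesis using d[OF T] T by simp
qed

end

locale separated_tower = mf_tower A \<iota> for A :: "nat \<Rightarrow> ('k::field, 'a) module" and \<iota> +
  fixes J :: "nat \<Rightarrow> 'a"
  assumes sep: "separating A \<iota> J"
begin

lemma J_GZ: "n \<ge> 1 \<Longrightarrow> J n \<in> GZ A \<iota> n"
  using sep unfolding separating_def by blast

lemma J_eigen:
  assumes "n \<ge> 1" "T \<in> Tab A \<iota> n"
  shows "J n \<otimes>\<^bsub>A n\<^esub> E T = content A \<iota> J T n \<odot>\<^bsub>A n\<^esub> E T"
  using path_coords_eigen[where n = n and k = n and J = J and T = T] J_GZ assms
  by (simp add: content_def Tab_length)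

text \<open>If the contents agreed, each generator \<open>J k\<close> would act on \<open>E S\<close> and \<open>E T\<close> by the same scalar: for
  \<open>k \<le> n\<close> it is the scalar on the common truncated path.  Then so would \<open>E S\<close>, but \<open>E S \<otimes> E S = E S\<close>
  and \<open>E S \<otimes> E T = 0\<close>.\<close>

lemma content_separates:
  assumes S: "S \<in> Tab A \<iota> (Suc n)" and T: "T \<in> Tab A \<iota> (Suc n)" and "butlast S = butlast T"
    and same: "content A \<iota> J S (Suc n) = content A \<iota> J T (Suc n)"
  shows "S = T"
proof (rule ccontr)
  assume "S \<noteq> T"
  let ?A = "A (Suc n)"
  let ?H = "{x \<in> carrier ?A. \<exists>c. \<forall>f\<in>{E S, E T}. x \<otimes>\<^bsub>?A\<^esub> f = c \<odot>\<^bsub>?A\<^esub> f}"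
  obtain R \<mu> where R: "S = R @ [\<mu>]" "R \<in> Tab A \<iota> n" using S by (rule Tab_Suc_cases)
  obtain \<nu> where T': "T = R @ [\<nu>]"
    using assms(3) R(1) Tab_nonempty[OF T] by (metis append_butlast_last_id butlast_snoc)
  have "incl \<iota> k (Suc n) (J k) \<in> ?H" if k: "k \<in> {1..Suc n}" for k
  proof (cases "k = Suc n")
    case True
    then show ?thesis using J_GZ[of "Suc n"] J_eigen[OF _ S] J_eigen[OF _ T] same by auto
  next
    case False
    then have kn: "1 \<le> k" "k \<le> n" using k by auto
    then have y: "incl \<iota> k n (J k) \<in> GZ A \<iota> n" using incl_GZ J_GZ by blast
    then obtain c where "incl \<iota> k n (J k) \<otimes>\<^bsub>A n\<^esub> E R = c \<odot>\<^bsub>A n\<^esub> E R" using GZ_eigen R(2) by blast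
    then have "incl \<iota> k (Suc n) (J k) \<otimes>\<^bsub>?A\<^esub> E S = c \<odot>\<^bsub>?A\<^esub> E S"
      "incl \<iota> k (Suc n) (J k) \<otimes>\<^bsub>?A\<^esub> E T = c \<odot>\<^bsub>?A\<^esub> E T"
      using iota_eigen[of "incl \<iota> k n (J k)" n R _ c] y S T R(1) T' kn by (auto simp: incl_Suc)
    then show ?thesis using kn J_GZ by auto
  qed
  then have "(\<lambda>k. incl \<iota> k (Suc n) (J k)) ` {1..Suc n} \<subseteq> ?H" by blast
  moreover have "unital_subalgebra ?H ?A"
    using eps_path_closed[OF S] eps_path_closed[OF T] by (intro alg.unital_subalgebra_eigen) simp
  ultimately have "generated_subalgebra ?A ((\<lambda>k. incl \<iota> k (Suc n) (J k)) ` {1..Suc n}) \<subseteq> ?H"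
    by (intro alg.generated_subalgebra_least)
  then have "GZ A \<iota> (Suc n) \<subseteq> ?H" using sep unfolding separating_def by simp
  then obtain c where c: "E S \<otimes>\<^bsub>?A\<^esub> E S = c \<odot>\<^bsub>?A\<^esub> E S" "E S \<otimes>\<^bsub>?A\<^esub> E T = c \<odot>\<^bsub>?A\<^esub> E T"
    using eps_path_GZ[OF S] by auto
  then have "c = 0"
    using eps_path_mult[OF S T] \<open>S \<noteq> T\<close> alg.scale_eq_zero[OF eps_path_closed[OF T] _ eps_path_nonzero[OF T]] by simp
  then show False
    using c(1) eps_path_mult[OF S S] eps_path_closed[OF S] eps_path_nonzero[OF S] by simp
qed

lemma interpolant_factor_GZ:
  assumes "n \<ge> 1" shows "c \<odot>\<^bsub>A n\<^esub> (J n \<ominus>\<^bsub>A n\<^esub> d \<odot>\<^bsub>A n\<^esub> \<one>\<^bsub>A n\<^esub>) \<in> GZ A \<iota> n"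
  using J_GZ[OF assms] GZ_D[where n = n] unfolding alg.minus_eq by metis

lemma interpolant_GZ:
  assumes "n \<ge> 1" "T \<in> Tab A \<iota> n" shows "interpolant A \<iota> J T \<in> GZ A \<iota> n"
proof -
  interpret M: comm_monoid "GZ_algebra A \<iota> n" by (rule GZ_comm_monoid)
  show ?thesis
    unfolding interpolant_def Let_def Tab_length[OF assms(2)] diff_Suc_1
    by (rule M.finprod_closed[unfolded GZ_algebra_simps])
      (use interpolant_factor_GZ[OF assms(1)] in simp)
qed

text \<open>Lagrange interpolation at the contents of the extensions of one path.\<close>

lemma interpolant_eps_path:
  assumes "n \<ge> 1" and S: "S \<in> Tab A \<iota> n" and T: "T \<in> Tab A \<iota> n" and bl: "butlast S = butlast T"
  shows "interpolant A \<iota> J T \<otimes>\<^bsub>A n\<^esub> E S = (if S = T then E S else \<zero>\<^bsub>A n\<^esub>)"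
proof -
  let ?c = "\<lambda>T. content A \<iota> J T n"
  let ?K = "{R \<in> Tab A \<iota> n. R \<noteq> T \<and> butlast R = butlast T}"
  have fin: "finite ?K" using finite_Tab finite_subset by auto
  note Sc = eps_path_closed[OF S]
  have "interpolant A \<iota> J T \<otimes>\<^bsub>A n\<^esub> E S = (\<Prod>R\<in>?K. (1 / (?c T - ?c R)) * (?c S - ?c R)) \<odot>\<^bsub>A n\<^esub> E S"
    unfolding interpolant_def Let_def Tab_length[OF T] diff_Suc_1
  proof (rule finprod_eigen[OF fin interpolant_factor_GZ[OF assms(1)] Sc])
    fix R
    have "(J n \<ominus>\<^bsub>A n\<^esub> ?c R \<odot>\<^bsub>A n\<^esub> \<one>\<^bsub>A n\<^esub>) \<otimes>\<^bsub>A n\<^esub> E S = ?c S \<odot>\<^bsub>A n\<^esub> E S \<oplus>\<^bsub>A n\<^esub> (- ?c R) \<odot>\<^bsub>A n\<^esub> E S"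
      using J_GZ[OF assms(1)] Sc J_eigen[OF assms(1) S]
      by (simp add: alg.minus_eq alg.l_distr alg.l_minus alg.minus_scale)
    also have "\<dots> = (?c S - ?c R) \<odot>\<^bsub>A n\<^esub> E S"
      using alg.add_scale[OF Sc, of "?c S" "- ?c R"] by simp
    finally show "(1 / (?c T - ?c R)) \<odot>\<^bsub>A n\<^esub> (J n \<ominus>\<^bsub>A n\<^esub> ?c R \<odot>\<^bsub>A n\<^esub> \<one>\<^bsub>A n\<^esub>) \<otimes>\<^bsub>A n\<^esub> E S
        = ((1 / (?c T - ?c R)) * (?c S - ?c R)) \<odot>\<^bsub>A n\<^esub> E S"
      using J_GZ[OF assms(1)] Sc by simp
  qed
  also have "(\<Prod>R\<in>?K. (1 / (?c T - ?c R)) * (?c S - ?c R)) = (if S = T then 1 else 0)"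
  proof (cases "S = T")
    case True
    obtain m where m: "n = Suc m" using assms(1) by (cases n) auto
    have "?c T \<noteq> ?c R" if "R \<in> ?K" for R using content_separates[of R m T] that T m by auto
    then show ?thesis using True by (intro trans[OF prod.neutral]) auto
  next
    case False
    then have "S \<in> ?K" using S bl by simp
    then show ?thesis using False fin by (auto intro!: bexI[of _ S])
  qed
  finally show ?thesis using Sc by (cases "S = T") auto
qed

text \<open>Both sides have the same product with every \<open>E S\<close>.  If \<open>S\<close> extends another path of length \<open>n\<close>, then
  \<open>P\<^sub>T(J\<^sub>n\<^sub>+\<^sub>1)\<close> acts on \<open>E S\<close> by a scalar that need not be known, because \<open>\<iota>(E (butlast T))\<close> annihilates
  \<open>E S\<close>.\<close>

lemma eps_path_interpolant:
  assumes T: "T \<in> Tab A \<iota> (Suc n)"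
  shows "E T = \<iota> n (E (butlast T)) \<otimes>\<^bsub>A (Suc n)\<^esub> interpolant A \<iota> J T"
proof (rule path_ext)
  let ?A = "A (Suc n)"
  obtain T' \<nu> where T': "T = T' @ [\<nu>]" "T' \<in> Tab A \<iota> n" using T by (rule Tab_Suc_cases)
  note Tc = eps_path_closed[OF T'(2)] and P = interpolant_GZ[OF _ T]
  show "E T \<in> carrier ?A" using eps_path_closed[OF T] .
  show "\<iota> n (E (butlast T)) \<otimes>\<^bsub>?A\<^esub> interpolant A \<iota> J T \<in> carrier ?A" using T' Tc P by simp
  fix S assume S: "S \<in> Tab A \<iota> (Suc n)"
  obtain S' \<mu> where S': "S = S' @ [\<mu>]" "S' \<in> Tab A \<iota> n" "\<mu> \<in> Irr ?A" using S by (rule Tab_Suc_cases)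
  note Sc = eps_path_closed[OF S]
  have prod: "\<iota> n (E T') \<otimes>\<^bsub>?A\<^esub> E S = (if S' = T' then E S else \<zero>\<^bsub>?A\<^esub>)"
    using iota_eps_path_mult[of S' \<mu> n "E T'"] S S' Tc eps_path_mult[OF T'(2) S'(2)]
    by (auto simp: eps_path_snoc)
  have "\<iota> n (E T') \<otimes>\<^bsub>?A\<^esub> interpolant A \<iota> J T \<otimes>\<^bsub>?A\<^esub> E S
      = \<iota> n (E T') \<otimes>\<^bsub>?A\<^esub> (interpolant A \<iota> J T \<otimes>\<^bsub>?A\<^esub> E S)"
    using Tc P Sc by (simp add: alg.m_assoc)
  also have "\<dots> = (if S = T then E S else \<zero>\<^bsub>?A\<^esub>)"
  proof (cases "S' = T'")
    case True
    then have "butlast S = butlast T" using S' T' by simp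
    then show ?thesis using interpolant_eps_path[OF _ S T] prod True Tc by auto
  next
    case False
    obtain c where "interpolant A \<iota> J T \<otimes>\<^bsub>?A\<^esub> E S = c \<odot>\<^bsub>?A\<^esub> E S" using GZ_eigen[OF P S] by auto
    then show ?thesis using False prod S' T' Sc Tc by simp
  qed
  finally show "E T \<otimes>\<^bsub>?A\<^esub> E S = \<iota> n (E (butlast T)) \<otimes>\<^bsub>?A\<^esub> interpolant A \<iota> J T \<otimes>\<^bsub>?A\<^esub> E S"
    using eps_path_mult[OF T S] T'(1) by auto
qed

lemma eps_path_product:
  "T \<in> Tab A \<iota> n \<Longrightarrow>
    E T = (\<Otimes>\<^bsub>GZ_algebra A \<iota> n\<^esub>k\<in>{1..n}. incl \<iota> k n (interpolant A \<iota> J (take (Suc k) T)))"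
proof (induction n arbitrary: T)
  case 0
  interpret M: comm_monoid "GZ_algebra A \<iota> 0" by (rule GZ_comm_monoid)
  show ?case using eps_path_0[OF 0] by simp
next
  case (Suc n)
  let ?G = "GZ_algebra A \<iota> (Suc n)"
  let ?f = "\<lambda>k. incl \<iota> k (Suc n) (interpolant A \<iota> J (take (Suc k) T))"
  interpret N: comm_monoid ?G by (rule GZ_comm_monoid)
  obtain S \<nu> where S: "T = S @ [\<nu>]" "S \<in> Tab A \<iota> n" using Suc.prems by (rule Tab_Suc_cases)
  have fG: "incl \<iota> k m (interpolant A \<iota> J (take (Suc k) R)) \<in> GZ A \<iota> m"
    if "R \<in> Tab A \<iota> m" "k \<in> {1..m}" for k m R
    using interpolant_GZ[OF _ Tab_take[OF that(1)], of k] incl_GZ that(2) by simp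
  have "\<iota> n (E S) = (\<Otimes>\<^bsub>?G\<^esub>k\<in>{1..n}. \<iota> n (incl \<iota> k n (interpolant A \<iota> J (take (Suc k) S))))"
    using iota_finprod[of "{1..n}" "\<lambda>k. incl \<iota> k n (interpolant A \<iota> J (take (Suc k) S))" n]
      fG[OF S(2)] Suc.IH[OF S(2)] by simp
  also have "\<dots> = finprod ?G ?f {1..n}"
  proof (rule N.finprod_cong')
    show "?f \<in> {1..n} \<rightarrow> carrier ?G" using fG[OF Suc.prems] by auto
    fix k assume k: "k \<in> {1..n}"
    then show "\<iota> n (incl \<iota> k n (interpolant A \<iota> J (take (Suc k) S))) = ?f k"
      using S Tab_length[OF S(2)] by (simp add: incl_Suc)
  qed simp
  finally have *: "\<iota> n (E (butlast T)) = finprod ?G ?f {1..n}" using S by simp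
  have last: "?f (Suc n) = interpolant A \<iota> J T" using Tab_length[OF Suc.prems] by simp
  have "finprod ?G ?f {1..Suc n} = ?f (Suc n) \<otimes>\<^bsub>?G\<^esub> finprod ?G ?f {1..n}"
  proof -
    have "{1..Suc n} = insert (Suc n) {1..n}" by auto
    then show ?thesis using fG[OF Suc.prems] by (simp only:) (intro N.finprod_insert, auto simp del: incl_self)
  qed
  also have "\<dots> = finprod ?G ?f {1..n} \<otimes>\<^bsub>?G\<^esub> ?f (Suc n)"
    using fG[OF Suc.prems] by (intro N.m_comm N.finprod_closed) (auto simp del: incl_self)
  also have "\<dots> = \<iota> n (E (butlast T)) \<otimes>\<^bsub>A (Suc n)\<^esub> interpolant A \<iota> J T" using * last by simp
  finally show ?case using eps_path_interpolant[OF Suc.prems] by simp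
qed

end

theorem theorem3p8:
  fixes A :: "nat \<Rightarrow> ('k::field, 'a) module"
    and \<iota> :: "nat \<Rightarrow> 'a \<Rightarrow> 'a"
    and J :: "nat \<Rightarrow> 'a"
    and n :: nat
    and T :: "('a, 'a) module set list"
  assumes "multiplicity_free_family A \<iota>"
    and "separating A \<iota> J"
    and "n \<ge> 1"
    and "T \<in> Tab A \<iota> n"
  shows "eps_path A \<iota> T = incl \<iota> (n - 1) n (eps_path A \<iota> (butlast T)) \<otimes>\<^bsub>A n\<^esub> interpolant A \<iota> J T
    \<and> eps_path A \<iota> T =
        (\<Otimes>\<^bsub>GZ_algebra A \<iota> n\<^esub>k\<in>{1..n}. incl \<iota> k n (interpolant A \<iota> J (take (Suc k) T)))"
proof -
  interpret separated_tower A \<iota> J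
    using assms(1,2) by unfold_locales
  obtain m where m: "n = Suc m" using assms(3) by (cases n) auto
  have "incl \<iota> (n - 1) n x = \<iota> m x" for x using incl_Suc[of m m x] m by simp
  then show ?thesis using eps_path_interpolant[of T m] eps_path_product[OF assms(4)] assms(4) m by simp
qed

end
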